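(* Let $\mathcal M$ be a finite set of real $n\times n$ matrices that is irreducible and asymptotically simple. Then its lifted set $\widetilde{\mathcal M}$ admits an extremal conitope. Moreover, there exists such an extremal conitope all of whose vertices are rank one matrices, i.e. an extremal conitope of the form $\mathrm{Coni}(U)$ with $U\subset\mathcal S^n_+$ a finite set of rank one matrices.
   Context: **Joint spectral radius.** For a finite set $\mathcal M$ of matrices (or linear operators), $\mathcal P_k(\mathcal M)$ is the set of all products of length $k$ of elements of $\mathcal M$, $\mathcal P(\mathcal M)=\bigcup_{k\ge 0}\mathcal P_k(\mathcal M)$ (with the identity for $k=0$), and $\rho(\mathcal M)=\lim_{k\to\infty}\sup_{P\in\mathcal P_k(\mathcal M)}\|P\|^{1/k}$. For a single matrix, $\rho(P)$ is its spectral radius. $\mathcal M$ is irreducible if its elements have no common invariant subspace of $\mathbb R^n$ other than $\{0\}$ and $\mathbb R^n$. **Lifting.** $\mathcal S^n_+$ is the cone of real symmetric positive semidefinite $n\times n$ matrices, and $X\preceq Y$ means $Y-X\in\mathcal S^n_+$. For $v\in\mathbb C^n$, $\widetilde v=\mathrm{Re}(vv^* )$. For a real matrix $A$, $\widetilde A$ is the linear operator on symmetric matrices, preserving $\mathcal S^n_+$, with $\widetilde A\,\widetilde v=\widetilde{Av}$, i.e. $\widetilde A(X)=AXA^T$. The lifted set is $\widetilde{\mathcal M}=\{\widetilde A:A\in\mathcal M\}$. **Conitopes.** For a finite $U=\{u_1,\dots,u_\ell\}\subset\mathcal S^n_+$, the conitope with vertices $U$ is $\mathrm{Coni}(U)=\{x\in\mathcal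 S^n_+:\exists\,\lambda_i\ge0,\ \sum_i\lambda_i=1,\ x\preceq\sum_i\lambda_iu_i\}$. If the convex hull of $U$ meets the interior of $\mathcal S^n_+$, then $|x|_U=\inf\{\lambda>0:x/\lambda\in\mathrm{Coni}(U)\}$ is the associated conitope norm on $\mathcal S^n_+$. The conitope $\mathrm{Coni}(U)$ is extremal for $\widetilde{\mathcal M}$ if the convex hull of $U$ meets the interior of $\mathcal S^n_+$ and $|\widetilde A x|_U\le\rho(\widetilde{\mathcal M})\,|x|_U$ for all $x\in\mathcal S^n_+$ and all $A\in\mathcal M$ (equivalently, $\mathrm{Coni}(U)$ is invariant under $\widetilde{\mathcal M}/\rho(\widetilde{\mathcal M})$). **Asymptotic simplicity.** Put $\mathcal M'=\mathcal M/\rho(\mathcal M)$ (with $\rho(\mathcal M)>0$). $\mathcal M$ is nondefective if $\mathcal P(\mathcal M')$ is bounded. A spectrum-maximizing product (SMP) is a product $\bar P\in\mathcal P_t(\mathcal M)$, $t\ge1$, with $\rho(\bar P)^{1/t}=\rho(\mathcal M)$; it is minimal if it is not a power of another SMP. A leading eigenvector of a matrix $P$ is a nonzero (complex) eigenvector for an eigenvalue of modulus $\rho(P)$. A leading eigenvector of $\mathcal M$ is a leading eigenvector of a matrix $P$ with $\rho(P)=1$ that is either a product of length $\ge 1$ of elements of $\mathcal M'$ or a limit of a sequence of such products. A nondefective set $\mathcal M$ is asymptotically simple if it has a minimal SMP $\bar P$ with only one leading eigenvector (modulo nonzero scalar factors) such that the set of leading eigenvectors of $\mathcal M$ is equal to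 the set of leading eigenvectors of $\bar P$ and of its cyclic permutations (if $\bar P=A_{i_k}\cdots A_{i_1}$, these are $A_{i_s}\cdots A_{i_1}A_{i_k}\cdots A_{i_{s+1}}$, $1\le s\le k-1$). *)

theory Defs
  imports "HOL-Analysis.Analysis"
begin

section \<open>Joint spectral radius\<close>

text \<open>Operator norm of a map on a subspace \<open>V\<close>; for \<open>V = UNIV\<close> this is \<^const>\<open>onorm\<close>.\<close>

definition onorm_on :: "'a::real_normed_vector set \<Rightarrow> ('a \<Rightarrow> 'a) \<Rightarrow> real" where
  "onorm_on V f = (SUP x\<in>V. norm (f x) / norm x)"

definition op_products :: "nat \<Rightarrow> ('a \<Rightarrow> 'a) set \<Rightarrow> ('a \<Rightarrow> 'a) set" where
  "op_products k F = {foldr (\<circ>) w id | w. length w = k \<and> set w \<subseteq> F}"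

text \<open>Joint spectral radius of a set of linear operators acting on a subspace \<open>V\<close>.\<close>

definition jsr_on :: "'a::real_normed_vector set \<Rightarrow> ('a \<Rightarrow> 'a) set \<Rightarrow> real" where
  "jsr_on V F = lim (\<lambda>k. SUP f\<in>op_products k F. root k (onorm_on V f))"

definition jsr :: "(real^'n^'n) set \<Rightarrow> real" where
  "jsr M = jsr_on UNIV ((*v) ` M)"

definition irreducible_set :: "(real^'n^'n) set \<Rightarrow> bool" where
  "irreducible_set M \<longleftrightarrow>
     (\<forall>V. subspace V \<and> (\<forall>A\<in>M. \<forall>x\<in>V. A *v x \<in> V) \<longrightarrow> V = {0} \<or> V = UNIV)"


section \<open>Spectral radius and leading eigenvectors of a matrix\<close>

definition complex_eigenvector :: "real^'n^'n \<Rightarrow> complex \<Rightarrow> complex^'n \<Rightarrow> bool" where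
  "complex_eigenvector P \<mu> v \<longleftrightarrow> v \<noteq> 0 \<and> map_matrix complex_of_real P *v v = \<mu> *s v"

definition spectral_radius :: "real^'n^'n \<Rightarrow> real" where
  "spectral_radius P = Max {cmod \<mu> | \<mu>. \<exists>v. complex_eigenvector P \<mu> v}"

definition leading_eigenvectors :: "real^'n^'n \<Rightarrow> (complex^'n) set" where
  "leading_eigenvectors P = {v. \<exists>\<mu>. cmod \<mu> = spectral_radius P \<and> complex_eigenvector P \<mu> v}"


section \<open>Asymptotic simplicity\<close>

text \<open>Products are represented by words, since cyclic permutations depend on the factorization.
  The word \<open>[A\<^sub>1, \<dots>, A\<^sub>k]\<close> denotes \<open>A\<^sub>1 \<cdots> A\<^sub>k\<close>.\<close>

definition mat_prod :: "(real^'n^'n) list \<Rightarrow> real^'n^'n" where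
  "mat_prod w = foldr (**) w (mat 1)"

definition normalized :: "(real^'n^'n) set \<Rightarrow> (real^'n^'n) set" where
  "normalized M = (\<lambda>A. A /\<^sub>R jsr M) ` M"

definition nondefective :: "(real^'n^'n) set \<Rightarrow> bool" where
  "nondefective M \<longleftrightarrow> jsr M > 0 \<and> bounded {mat_prod w | w. set w \<subseteq> normalized M}"

definition is_SMP :: "(real^'n^'n) set \<Rightarrow> (real^'n^'n) list \<Rightarrow> bool" where
  "is_SMP M w \<longleftrightarrow> set w \<subseteq> M \<and> length w \<ge> 1
     \<and> root (length w) (spectral_radius (mat_prod w)) = jsr M"

definition is_minimal_SMP :: "(real^'n^'n) set \<Rightarrow> (real^'n^'n) list \<Rightarrow> bool" where
  "is_minimal_SMP M w \<longleftrightarrow> is_SMP M w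
     \<and> \<not> (\<exists>v m. is_SMP M v \<and> v \<noteq> w \<and> w = concat (replicate m v))"

definition nonempty_products :: "(real^'n^'n) set \<Rightarrow> (real^'n^'n) set" where
  "nonempty_products M = {mat_prod w | w. set w \<subseteq> M \<and> length w \<ge> 1}"

definition set_leading_eigenvectors :: "(real^'n^'n) set \<Rightarrow> (complex^'n) set" where
  "set_leading_eigenvectors M =
     {v. \<exists>P. spectral_radius P = 1
          \<and> (P \<in> nonempty_products (normalized M)
             \<or> (\<exists>X. (\<forall>j. X j \<in> nonempty_products (normalized M)) \<and> X \<longlonglongrightarrow> P))
          \<and> v \<in> leading_eigenvectors P}"

text \<open>In the last clause \<open>rotate 0 w = w\<close>, so the union covers the product itself and its cyclic
  permutations.\<close>

definition asymptotically_simple :: "(real^'n^'n) set \<Rightarrow> bool" where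
  "asymptotically_simple M \<longleftrightarrow> nondefective M \<and>
     (\<exists>w. is_minimal_SMP M w
        \<and> (\<exists>v. leading_eigenvectors (mat_prod w) = {c *s v | c. c \<noteq> 0})
        \<and> set_leading_eigenvectors M =
            (\<Union>s<length w. leading_eigenvectors (mat_prod (rotate s w))))"


section \<open>Lifting\<close>

definition sym_matrices :: "(real^'n^'n) set" where
  "sym_matrices = {X. transpose X = X}"

definition psd_cone :: "(real^'n^'n) set" where
  "psd_cone = {X \<in> sym_matrices. \<forall>x. 0 \<le> x \<bullet> (X *v x)}"

definition psd_le :: "real^'n^'n \<Rightarrow> real^'n^'n \<Rightarrow> bool" where
  "psd_le X Y \<longleftrightarrow> Y - X \<in> psd_cone"

definition lift_op :: "real^'n^'n \<Rightarrow> real^'n^'n \<Rightarrow> real^'n^'n" where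
  "lift_op A X = A ** X ** transpose A"

definition lifted_set :: "(real^'n^'n) set \<Rightarrow> (real^'n^'n \<Rightarrow> real^'n^'n) set" where
  "lifted_set M = lift_op ` M"


section \<open>Conitopes\<close>

definition Coni :: "(real^'n^'n) set \<Rightarrow> (real^'n^'n) set" where
  "Coni U = {x \<in> psd_cone. \<exists>l. (\<forall>u\<in>U. 0 \<le> l u) \<and> (\<Sum>u\<in>U. l u) = 1
                               \<and> psd_le x (\<Sum>u\<in>U. l u *\<^sub>R u)}"

definition conitope_norm :: "(real^'n^'n) set \<Rightarrow> real^'n^'n \<Rightarrow> real" where
  "conitope_norm U x = Inf {l. l > 0 \<and> x /\<^sub>R l \<in> Coni U}"

text \<open>The interior of the cone and the joint spectral radius of \<open>F\<close> are both taken in the space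
  of symmetric matrices; in \<^typ>\<open>real^'n^'n\<close> the cone would have empty interior for
  \<open>CARD('n) \<ge> 2\<close>.\<close>

definition extremal_conitope ::
  "(real^'n^'n \<Rightarrow> real^'n^'n) set \<Rightarrow> (real^'n^'n) set \<Rightarrow> bool" where
  "extremal_conitope F U \<longleftrightarrow> finite U \<and> U \<subseteq> psd_cone
     \<and> convex hull U \<inter> (top_of_set sym_matrices interior_of psd_cone) \<noteq> {}
     \<and> (\<forall>f\<in>F. \<forall>x\<in>psd_cone.
          conitope_norm U (f x) \<le> jsr_on sym_matrices F * conitope_norm U x)"

end

theory Submission
  imports Defs
begin

text \<open>
  After division by the joint spectral radius the products of \<open>M\<close> stay bounded. For a real vector
  \<open>z\<close> write \<open>zz\<^sup>T\<close> for its lift. If \<open>y\<close> is a convex combination of vectors \<open>z\<close>, then \<open>yy\<^sup>T\<close> is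
  dominated by the same combination of the lifts \<open>zz\<^sup>T\<close>. Hence a polytope in \<open>\<real>\<^sup>n\<close> that contains \<open>0\<close> in
  its interior and is mapped into itself by every normalized matrix yields an extremal conitope, the
  one spanned by the lifts of the vertices, which have rank one
  (\<open>extremal_conitope_if_invariant_polytope\<close>). The constant is right because the joint spectral
  radius of the lifted set is the square of that of \<open>M\<close> (\<open>jsr_on_lifted_set\<close>).

  The real reduction is possible because the leading eigenvector of the given spectrum-maximizing
  product is unique up to scalars: its complex conjugate is again a leading eigenvector, so it
  can be taken real. Its images along the cycle of the product form a finite set \<open>G\<close> of real
  vectors. Asymptotic simplicity says that \<open>G\<close> contains, up to scalars, all real vectors that a
  limit of normalized products multiplies by \<open>1\<close> or \<open>-1\<close>, and products carry the vectors of \<open>G\<close> to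
  each other up to sign. These two properties, with boundedness and irreducibility, are the locale
  \<open>leading_cycle\<close>.

  The polytope is the closed absolutely convex hull \<open>K\<close> of the orbit of \<open>G\<close>. It is invariant by
  construction, and irreducibility gives it interior points. The point is that \<open>K\<close> has finitely
  many extreme points. Suppose that a step leads from \<open>G\<close> to a vector \<open>y\<close> off the lines through
  \<open>G\<close>, and that arbitrarily long products keep \<open>y\<close> out of the interior of \<open>K\<close>. By compactness
  some limits \<open>P\<close>, \<open>Q\<close> of products satisfy \<open>QPy = Py\<close>, so \<open>Py\<close> lies on a line through \<open>G\<close>. Going from
  there around the cycle and taking the step to \<open>y\<close> again closes a loop: \<open>y\<close> itself is a
  leading eigenvector of a limit of products, hence on a line through \<open>G\<close>, a contradiction
  (\<open>eventually_interior\<close>). So an orbit that leaves the lines through \<open>G\<close> is pushed into a shrunken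
  copy of \<open>K\<close> after a bounded number of steps, unless it returns to one of these lines. All
  remaining orbit points are multiples, by factors in \<open>[-1, 1]\<close>, of finitely many vectors
  (\<open>orbit_cover\<close>), and the extreme points of \<open>K\<close> are among these vectors and their negatives.
\<close>

section \<open>Matrix products and eigenvalues\<close>

lemma matrix_mult_scaleR_left: "(k *\<^sub>R A) ** B = k *\<^sub>R (A ** B)"
  and matrix_mult_scaleR_right: "A ** (k *\<^sub>R B) = k *\<^sub>R (A ** B)"
  for A :: "real^'n^'m"
  by (simp_all add: vec_eq_iff matrix_matrix_mult_def sum_distrib_left mult_ac)

lemma bounded_bilinear_matrix_mult:
  "bounded_bilinear ((**) :: real^'n^'m \<Rightarrow> real^'p^'n \<Rightarrow> real^'p^'m)"
proof -
  have "bilinear ((**) :: real^'n^'m \<Rightarrow> real^'p^'n \<Rightarrow> real^'p^'m)"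
    unfolding bilinear_def
    by (auto intro!: linearI simp: matrix_mult_scaleR_left matrix_mult_scaleR_right
        vec_eq_iff matrix_matrix_mult_def sum.distrib distrib_left distrib_right
        sum_distrib_left mult_ac)
  then show ?thesis
    by (simp add: bilinear_conv_bounded_bilinear)
qed

lemma bounded_bilinear_matrix_vector_mult:
  "bounded_bilinear ((*v) :: real^'n^'m \<Rightarrow> real^'n \<Rightarrow> real^'m)"
proof -
  have "bilinear ((*v) :: real^'n^'m \<Rightarrow> real^'n \<Rightarrow> real^'m)"
    unfolding bilinear_def
    by (auto intro!: linearI simp: matrix_vector_mult_add_rdistrib matrix_vector_right_distrib
        scaleR_matrix_vector_assoc[symmetric] matrix_vector_mult_scaleR)
  then show ?thesis
    by (simp add: bilinear_conv_bounded_bilinear)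
qed

lemmas tendsto_matrix_mult = bounded_bilinear.tendsto[OF bounded_bilinear_matrix_mult]
lemmas tendsto_matrix_vector_mult =
  bounded_bilinear.tendsto[OF bounded_bilinear_matrix_vector_mult]

lemma mat_prod_Nil [simp]: "mat_prod [] = mat 1"
  and mat_prod_Cons [simp]: "mat_prod (A # w) = A ** mat_prod w"
  by (simp_all add: mat_prod_def)

lemma mat_prod_append: "mat_prod (a @ b) = mat_prod a ** mat_prod b"
  by (induction a) (simp_all add: matrix_mul_assoc)

lemma mat_prod_map_scaleR:
  "mat_prod (map (\<lambda>A. A /\<^sub>R r) w) = mat_prod w /\<^sub>R r ^ length w"
  by (induction w)
    (simp_all add: matrix_mult_scaleR_left matrix_mult_scaleR_right)

text \<open>
  Applying \<open>P - \<nu>\<close> to a vanishing combination of eigenvectors removes the term of \<open>\<nu>\<close> and multiplies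
  the coefficient of every other \<open>\<mu>\<close> by \<open>\<mu> - \<nu> \<noteq> 0\<close>, so induction on the number of eigenvalues
  applies.
\<close>

lemma eigenvector_sums_independent:
  fixes P :: "complex^'n^'n" and v :: "complex \<Rightarrow> complex^'n"
  assumes "finite E"
    and "\<And>\<mu>. \<mu> \<in> E \<Longrightarrow> v \<mu> \<noteq> 0"
    and "\<And>\<mu>. \<mu> \<in> E \<Longrightarrow> P *v v \<mu> = \<mu> *s v \<mu>"
    and "(\<Sum>\<mu>\<in>E. c \<mu> *s v \<mu>) = 0"
    and "\<mu> \<in> E"
  shows "c \<mu> = 0"
  using assms
proof (induction E arbitrary: c \<mu> rule: finite_induct)
  case empty
  then show ?case by simp
next
  case (insert \<nu> E)
  have "(\<Sum>\<mu>\<in>insert \<nu> E. (c \<mu> * (\<mu> - \<nu>)) *s v \<mu>)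
      = P *v (\<Sum>\<mu>\<in>insert \<nu> E. c \<mu> *s v \<mu>) - \<nu> *s (\<Sum>\<mu>\<in>insert \<nu> E. c \<mu> *s v \<mu>)"
  proof -
    have "(c \<mu> * (\<mu> - \<nu>)) *s v \<mu> = P *v (c \<mu> *s v \<mu>) - \<nu> *s (c \<mu> *s v \<mu>)"
      if "\<mu> \<in> insert \<nu> E" for \<mu>
      using insert.prems(2)[OF that]
      by (simp add: vector_scalar_commute vec_eq_iff algebra_simps)
    then show ?thesis
      by (simp only: vec.scale_sum_right vec.linear_sum[OF matrix_vector_mul_linear_gen]
          sum_subtractf cong: sum.cong)
  qed
  also have "\<dots> = 0"
    by (simp add: insert.prems(3))
  finally have "(\<Sum>\<mu>\<in>E. (c \<mu> * (\<mu> - \<nu>)) *s v \<mu>) = 0"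
    using insert.hyps by simp
  then have "c \<mu> * (\<mu> - \<nu>) = 0" if "\<mu> \<in> E" for \<mu>
    using insert.IH[of "\<lambda>\<mu>. c \<mu> * (\<mu> - \<nu>)"] insert.prems(1,2) that by blast
  then have z: "c \<mu> = 0" if "\<mu> \<in> E" for \<mu>
    using insert.hyps that by force
  then have "c \<nu> *s v \<nu> = 0"
    using insert.prems(3) insert.hyps by simp
  then have "c \<nu> = 0"
    using insert.prems(1)[of \<nu>] by (simp add: vec.scale_eq_0_iff)
  then show ?case
    using z insert.prems(4) by blast
qed

text \<open>
  Without finiteness, the \<^const>\<open>Max\<close> in the definition of the spectral radius would be
  meaningless.
\<close>

lemma finite_eigenvalues:
  fixes P :: "complex^'n^'n"
  shows "finite {\<mu>. \<exists>v. v \<noteq> 0 \<and> P *v v = \<mu> *s v}"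
proof (rule ccontr)
  let ?S = "{\<mu>. \<exists>v. v \<noteq> 0 \<and> P *v v = \<mu> *s v}"
  assume "infinite ?S"
  then obtain E where E: "finite E" "card E = Suc CARD('n)" "E \<subseteq> ?S"
    using infinite_arbitrarily_large by blast
  then have "\<forall>\<mu>. \<exists>v. \<mu> \<in> E \<longrightarrow> v \<noteq> 0 \<and> P *v v = \<mu> *s v"
    by blast
  then obtain v where v: "\<And>\<mu>. \<mu> \<in> E \<Longrightarrow> v \<mu> \<noteq> 0 \<and> P *v v \<mu> = \<mu> *s v \<mu>"
    by metis
  have inj: "inj_on v E"
  proof (rule inj_onI)
    fix a b assume "a \<in> E" "b \<in> E" "v a = v b"
    then have "a *s v a = b *s v a"
      using v by metis
    then show "a = b"
      using v[OF \<open>a \<in> E\<close>] vec.scale_cancel_right by blast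
  qed
  have "vec.independent (v ` E)"
  proof
    assume "vec.dependent (v ` E)"
    then obtain u x where u: "x \<in> E" "u (v x) \<noteq> 0" "(\<Sum>y\<in>v ` E. u y *s y) = 0"
      using vec.dependent_finite[of "v ` E"] E(1) by auto
    then have "(\<Sum>\<mu>\<in>E. u (v \<mu>) *s v \<mu>) = 0"
      by (simp add: sum.reindex[OF inj])
    then show False
      using eigenvector_sums_independent[of E v P "\<lambda>\<mu>. u (v \<mu>)" x] E v u by blast
  qed
  then have "card (v ` E) \<le> vec.dim (UNIV :: (complex^'n) set)"
    by (intro vec.independent_card_le_dim) auto
  then show False
    using E card_image[OF inj] by (simp add: card_cart_basis)
qed

lemma spectral_radius_eqI:
  assumes "complex_eigenvector P \<nu> u" "cmod \<nu> = \<rho>"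
    and "\<And>\<mu> v. complex_eigenvector P \<mu> v \<Longrightarrow> cmod \<mu> \<le> \<rho>"
  shows "spectral_radius P = \<rho>"
proof -
  have "finite {\<mu>. \<exists>v. complex_eigenvector P \<mu> v}"
    unfolding complex_eigenvector_def by (rule finite_eigenvalues)
  moreover have "{cmod \<mu> | \<mu>. \<exists>v. complex_eigenvector P \<mu> v}
      = cmod ` {\<mu>. \<exists>v. complex_eigenvector P \<mu> v}"
    by auto
  ultimately have "finite {cmod \<mu> | \<mu>. \<exists>v. complex_eigenvector P \<mu> v}"
    by simp
  then show ?thesis
    unfolding spectral_radius_def using assms by (intro Max_eqI) auto
qed

definition complexify :: "real^'n \<Rightarrow> complex^'n" where
  "complexify x = (\<chi> i. complex_of_real (x $ i))"

lemma complexify_nth [simp]: "complexify x $ i = complex_of_real (x $ i)"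
  by (simp add: complexify_def)

lemma complexify_eq_0_iff [simp]: "complexify x = 0 \<longleftrightarrow> x = 0"
  by (simp add: vec_eq_iff)

lemma complexify_matrix_vector_mult:
  "map_matrix complex_of_real P *v complexify x = complexify (P *v x)"
  by (simp add: vec_eq_iff matrix_vector_mult_def map_matrix_def)

lemma complex_eigenvector_complexify:
  "complex_eigenvector P (complex_of_real c) (complexify x) \<longleftrightarrow> x \<noteq> 0 \<and> P *v x = c *\<^sub>R x"
  unfolding complex_eigenvector_def complexify_matrix_vector_mult complexify_eq_0_iff
  by (auto simp: vec_eq_iff simp flip: of_real_mult)

lemma map_matrix_of_real_mult:
  "map_matrix complex_of_real (P ** Q) = map_matrix complex_of_real P ** map_matrix complex_of_real Q"
  by (simp add: vec_eq_iff map_matrix_def matrix_matrix_mult_def)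

section \<open>Bounded matrix semigroups\<close>

definition products :: "(real^'n^'n) set \<Rightarrow> (real^'n^'n) set" where
  "products N = {mat_prod w | w. set w \<subseteq> N}"

lemma mat_prod_in_products: "set w \<subseteq> N \<Longrightarrow> mat_prod w \<in> products N"
  by (auto simp: products_def)

lemma closure_products_mult:
  assumes "P \<in> closure (products N)" "Q \<in> closure (products N)"
  shows "P ** Q \<in> closure (products N)"
proof -
  obtain X Y where X: "\<And>k. X k \<in> products N" "X \<longlonglongrightarrow> P"
    and Y: "\<And>k. Y k \<in> products N" "Y \<longlonglongrightarrow> Q"
    using assms unfolding closure_sequential by blast
  have "X k ** Y k \<in> products N" for k
  proof -
    obtain a b where "set a \<subseteq> N" "set b \<subseteq> N" "X k = mat_prod a" "Y k = mat_prod b"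
      using X(1)[of k] Y(1)[of k] unfolding products_def by blast
    then show ?thesis
      using mat_prod_in_products[of "a @ b" N] by (simp add: mat_prod_append)
  qed
  then show ?thesis
    using tendsto_matrix_mult[OF X(2) Y(2)] unfolding closure_sequential
    by (intro exI[of _ "\<lambda>k. X k ** Y k"]) simp
qed

lemma nonempty_products_mult_closure:
  assumes "set u \<subseteq> N" "u \<noteq> []" "P \<in> closure (products N)"
  shows "mat_prod u ** P \<in> closure (nonempty_products N)"
proof -
  obtain X where X: "\<And>k. X k \<in> products N" "X \<longlonglongrightarrow> P"
    using assms unfolding closure_sequential by blast
  have "mat_prod u ** X k \<in> nonempty_products N" for k
  proof -
    obtain a where "set a \<subseteq> N" "X k = mat_prod a"
      using X(1)[of k] unfolding products_def by blast
    then show ?thesis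
      using assms(1,2) unfolding nonempty_products_def
      by (auto intro!: exI[of _ "u @ a"] simp: mat_prod_append Suc_le_eq)
  qed
  then show ?thesis
    using tendsto_matrix_mult[OF tendsto_const X(2)] unfolding closure_sequential
    by (intro exI[of _ "\<lambda>k. mat_prod u ** X k"]) simp
qed

lemma closure_nonempty_products_subset: "closure (nonempty_products N) \<subseteq> closure (products N)"
  by (intro closure_mono) (auto simp: nonempty_products_def products_def)

text \<open>
  The powers of \<open>Q\<close> are again limits of products, so \<open>\<mu> ^ k\<close> times a nonzero entry of the eigenvector
  stays bounded as \<open>k\<close> grows.
\<close>

lemma eigenvalue_le_1_if_bounded_products:
  fixes N :: "(real^'n^'n) set"
  assumes bdd: "bounded (products N)" and Q: "Q \<in> closure (products N)"
    and ev: "complex_eigenvector Q \<mu> v"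
  shows "cmod \<mu> \<le> 1"
proof (rule ccontr)
  assume gt: "\<not> cmod \<mu> \<le> 1"
  let ?C = "map_matrix complex_of_real"
  obtain B where B: "\<And>P. P \<in> closure (products N) \<Longrightarrow> norm P \<le> B"
    using bounded_closure[OF bdd] unfolding bounded_iff by blast
  define R where "R k = (((**) Q) ^^ k) (mat 1)" for k
  have R: "R k \<in> closure (products N) \<and> ?C (R k) *v v = \<mu> ^ k *s v" for k
  proof (induction k)
    case 0
    have "?C (mat 1 :: real^'n^'n) = mat 1"
      by (simp add: vec_eq_iff map_matrix_def mat_def)
    moreover have "(mat 1 :: real^'n^'n) \<in> closure (products N)"
      using mat_prod_in_products[of "[]" N] closure_subset by fastforce
    ultimately show ?case
      by (simp add: R_def)
  next
    case (Suc k)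
    then have "?C (R (Suc k)) *v v = ?C Q *v (\<mu> ^ k *s v)"
      by (simp add: R_def map_matrix_of_real_mult flip: matrix_vector_mul_assoc)
    also have "\<dots> = \<mu> ^ Suc k *s v"
      using ev by (simp add: complex_eigenvector_def vector_scalar_commute mult.commute)
    finally show ?case
      using Suc closure_products_mult[OF Q] by (simp add: R_def)
  qed
  obtain i where i: "v $ i \<noteq> 0"
    using ev by (auto simp: complex_eigenvector_def vec_eq_iff)
  have bound: "cmod \<mu> ^ k \<le> (\<Sum>j\<in>UNIV. B * cmod (v $ j)) / cmod (v $ i)" for k
  proof -
    have "cmod \<mu> ^ k * cmod (v $ i) = cmod ((?C (R k) *v v) $ i)"
      using R[of k] by (simp add: norm_mult norm_power)
    also have "\<dots> = cmod (\<Sum>j\<in>UNIV. of_real (R k $ i $ j) * v $ j)"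
      by (simp add: matrix_vector_mult_def map_matrix_def)
    also have "\<dots> \<le> (\<Sum>j\<in>UNIV. B * cmod (v $ j))"
    proof (intro sum_norm_le)
      fix j
      have "\<bar>R k $ i $ j\<bar> \<le> norm (R k $ i)"
        by (rule component_le_norm_cart)
      also have "\<dots> \<le> norm (R k)"
        by (rule Finite_Cartesian_Product.norm_nth_le)
      also have "\<dots> \<le> B"
        using R B by blast
      finally show "cmod (of_real (R k $ i $ j) * v $ j) \<le> B * cmod (v $ j)"
        by (simp add: norm_mult mult_right_mono)
    qed
    finally show ?thesis
      using i by (simp add: pos_le_divide_eq)
  qed
  show False
    using real_arch_pow[of "cmod \<mu>" "(\<Sum>j\<in>UNIV. B * cmod (v $ j)) / cmod (v $ i)"] gt bound
    by (meson not_le)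
qed

lemma real_eigenvalue_le_1_if_bounded_products:
  assumes "bounded (products N)" "Q \<in> closure (products N)" "x \<noteq> 0" "Q *v x = c *\<^sub>R x"
  shows "\<bar>c\<bar> \<le> 1"
  using eigenvalue_le_1_if_bounded_products[of N Q "of_real c" "complexify x"] assms
  by (simp add: complex_eigenvector_complexify)

text \<open>
  Among more points than there are balls of radius \<open>e / 2\<close> in a finite cover of \<open>S\<close>, two lie in the same
  ball.
\<close>

lemma compact_recurrence:
  fixes S :: "'a::metric_space set"
  assumes "compact S" "0 < e"
  shows "\<exists>L::nat. \<forall>x. (\<forall>i\<le>L. x i \<in> S) \<longrightarrow> (\<exists>i j. i < j \<and> j \<le> L \<and> dist (x i) (x j) < e)"
proof -
  obtain F where F: "finite F" "S \<subseteq> (\<Union>c\<in>F. ball c (e / 2))"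
    using assms unfolding compact_eq_totally_bounded by (meson half_gt_zero)
  have "\<exists>i j. i < j \<and> j \<le> card F \<and> dist (x i) (x j) < e"
    if x: "\<forall>i\<le>card F. x i \<in> S" for x :: "nat \<Rightarrow> 'a"
  proof -
    have "\<forall>i. \<exists>c. i \<le> card F \<longrightarrow> c \<in> F \<and> dist c (x i) < e / 2"
      using x F(2) by fastforce
    then obtain f where f: "\<And>i. i \<le> card F \<Longrightarrow> f i \<in> F \<and> dist (f i) (x i) < e / 2"
      by metis
    have "\<not> inj_on f {..card F}"
    proof
      assume "inj_on f {..card F}"
      then have "card {..card F} \<le> card F"
        using f F(1) by (intro card_inj_on_le[of f]) auto
      then show False by simp
    qed
    then obtain i j where ij: "i \<noteq> j" "f i = f j" "i \<le> card F" "j \<le> card F"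
      by (auto simp: inj_on_def)
    then have "dist (x i) (x j) < e"
      using f[of i] f[of j] by (metis dist_commute dist_triangle_half_r)
    then show ?thesis
      using ij by (metis dist_commute linorder_neqE_nat)
  qed
  then show ?thesis
    by (intro exI[of _ "card F"]) simp
qed

section \<open>The invariant polytope of a leading cycle\<close>

text \<open>
  The properties of the leading eigenvectors of an asymptotically simple set that the polytope needs:
  \<open>N\<close> is the normalized set and \<open>G\<close> holds a real leading eigenvector of a spectrum-maximizing product
  and of each of its cyclic permutations.
\<close>

locale leading_cycle =
  fixes N :: "(real^'n^'n) set" and G :: "(real^'n) set"
  assumes finite_N: "finite N"
    and irreducible: "irreducible_set N"
    and bounded_products: "bounded (products N)"
    and finite_G: "finite G" and G_nonempty: "G \<noteq> {}" and zero_notin_G: "0 \<notin> G"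
    and leading: "\<lbrakk>Q \<in> closure (nonempty_products N); x \<noteq> 0; Q *v x = c *\<^sub>R x; \<bar>c\<bar> = 1\<rbrakk>
      \<Longrightarrow> \<exists>g\<in>G. x \<in> span {g}"
    and connected: "\<lbrakk>g \<in> G; h \<in> G\<rbrakk>
      \<Longrightarrow> \<exists>w c. set w \<subseteq> N \<and> \<bar>c\<bar> = 1 \<and> mat_prod w *v g = c *\<^sub>R h"
begin

definition orbit :: "(real^'n) set" where
  "orbit = {mat_prod w *v g | w g. set w \<subseteq> N \<and> g \<in> G}"

definition body :: "(real^'n) set" where
  "body = convex hull closure (orbit \<union> uminus ` orbit)"

lemma orbit_step: "A \<in> N \<Longrightarrow> x \<in> orbit \<Longrightarrow> A *v x \<in> orbit"
  unfolding orbit_def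
  by (clarsimp, rule_tac x = "A # w" in exI) (auto simp: matrix_vector_mul_assoc)

lemma orbit_subset_body: "orbit \<subseteq> body"
  unfolding body_def using closure_subset hull_subset by fastforce

lemma G_subset_orbit: "G \<subseteq> orbit"
  unfolding orbit_def by (auto intro!: exI[of _ "[]"])

lemma bounded_orbit: "bounded orbit"
proof -
  obtain B where B: "\<And>P. P \<in> products N \<Longrightarrow> norm P \<le> B"
    using bounded_products unfolding bounded_iff by blast
  obtain D where D: "\<And>g. g \<in> G \<Longrightarrow> norm g \<le> D"
    using finite_imp_bounded[OF finite_G] unfolding bounded_iff by blast
  obtain K where K: "\<And>P x. norm ((P :: real^'n^'n) *v x) \<le> norm P * norm x * K" "0 < K"
    using bounded_bilinear.pos_bounded[OF bounded_bilinear_matrix_vector_mult] by blast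
  have "norm x \<le> B * D * K" if "x \<in> orbit" for x
  proof -
    obtain w g where w: "set w \<subseteq> N" "g \<in> G" "x = mat_prod w *v g"
      using \<open>x \<in> orbit\<close> unfolding orbit_def by blast
    have "norm x \<le> norm (mat_prod w) * norm g * K"
      using K(1) w(3) by simp
    also have "\<dots> \<le> B * D * K"
      using B[OF mat_prod_in_products[OF w(1)]] D[OF w(2)] K(2)
      by (intro mult_right_mono mult_mono) (auto intro: order_trans[OF norm_ge_zero])
    finally show ?thesis .
  qed
  then show ?thesis
    unfolding bounded_iff by blast
qed

lemma compact_closure_orbit: "compact (closure (orbit \<union> uminus ` orbit))"
  unfolding compact_closure using bounded_orbit by simp

lemma compact_body: "compact body"
  unfolding body_def using compact_closure_orbit by (rule compact_convex_hull)

lemma convex_body: "convex body"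
  unfolding body_def by simp

text \<open>
  Both the matrices of \<open>N\<close> and the negation map the generating set of the body into itself; this
  transfers such invariance to the body.
\<close>

lemma body_image_subset:
  assumes "linear f" "f ` (orbit \<union> uminus ` orbit) \<subseteq> orbit \<union> uminus ` orbit"
  shows "f ` body \<subseteq> body"
proof -
  have "f ` closure (orbit \<union> uminus ` orbit) \<subseteq> closure (orbit \<union> uminus ` orbit)"
    using assms closure_subset[of "orbit \<union> uminus ` orbit"]
    by (intro image_closure_subset linear_continuous_on order_trans[OF assms(2)])
      (simp_all only: linear_conv_bounded_linear closed_closure)
  then show ?thesis
    unfolding body_def convex_hull_linear_image[OF assms(1)] by (rule hull_mono)
qed

lemma body_step: "A \<in> N \<Longrightarrow> x \<in> body \<Longrightarrow> A *v x \<in> body"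
proof -
  assume "A \<in> N" "x \<in> body"
  have "A *v (- x) = - (A *v x)" for x
    by (metis matrix_vector_mul_linear linear_neg)
  then have "(\<lambda>x. A *v x) ` body \<subseteq> body"
    using orbit_step[OF \<open>A \<in> N\<close>] by (intro body_image_subset) auto
  then show ?thesis
    using \<open>x \<in> body\<close> by blast
qed

lemma uminus_body: "x \<in> body \<Longrightarrow> - x \<in> body"
proof -
  assume "x \<in> body"
  have "uminus ` body \<subseteq> body"
    by (intro body_image_subset) (auto intro!: linearI)
  then show ?thesis
    using \<open>x \<in> body\<close> by blast
qed

lemma body_mult: "set w \<subseteq> N \<Longrightarrow> x \<in> body \<Longrightarrow> mat_prod w *v x \<in> body"
  by (induction w) (auto intro: body_step simp flip: matrix_vector_mul_assoc)

text \<open>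
  The span of the orbit is a nonzero common invariant subspace.
\<close>

lemma span_orbit: "span orbit = UNIV"
proof -
  have "A *v x \<in> span orbit" if "A \<in> N" "x \<in> span orbit" for A x
  proof -
    have "(\<lambda>x. A *v x) ` span orbit = span ((\<lambda>x. A *v x) ` orbit)"
      by (simp add: linear_span_image)
    also have "\<dots> \<subseteq> span orbit"
      using orbit_step[OF that(1)] by (intro span_mono) auto
    finally show ?thesis
      using that(2) by blast
  qed
  then have "span orbit = {0} \<or> span orbit = UNIV"
    using irreducible unfolding irreducible_set_def by blast
  moreover obtain g where "g \<in> G" "g \<noteq> 0"
    using G_nonempty zero_notin_G by blast
  ultimately show ?thesis
    using G_subset_orbit span_superset by blast
qed

text \<open>
  A convex set without interior points lies in a hyperplane. For the body this hyperplane passes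
  through \<open>0\<close>, so it would contain the span of the orbit, which is the whole space.
\<close>

lemma zero_in_interior_body: "0 \<in> interior body"
proof -
  obtain g where "g \<in> body"
    using G_nonempty G_subset_orbit orbit_subset_body by blast
  then have zero: "0 \<in> body"
    using convexD[OF convex_body, of g "- g" "1/2" "1/2"] uminus_body by simp
  have "interior body \<noteq> {}"
  proof
    assume "interior body = {}"
    then obtain a b where ab: "a \<noteq> 0" "body \<subseteq> {x. a \<bullet> x = b}"
      using empty_interior_subset_hyperplane[OF convex_body] by blast
    then have "b = 0"
      using zero by auto
    then have "orbit \<subseteq> {x. a \<bullet> x = 0}"
      using ab(2) orbit_subset_body by blast
    then have "span orbit \<subseteq> {x. a \<bullet> x = 0}"
      by (simp add: span_minimal subspace_hyperplane)
    then have "a \<bullet> a = 0"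
      using span_orbit by blast
    then show False
      using ab(1) by simp
  qed
  then obtain x where x: "x \<in> interior body"
    by blast
  have "uminus ` body = body"
    using uminus_body by (force simp: image_iff)
  then have "- x \<in> interior body"
    using x interior_negations[of body] by (metis imageI)
  then show ?thesis
    using convexD[OF convex_interior[OF convex_body] x, of "- x" "1/2" "1/2"] by simp
qed

lemma zero_in_body: "0 \<in> body"
  using zero_in_interior_body interior_subset by blast

lemma scaleR_body: "x \<in> body \<Longrightarrow> \<bar>c\<bar> \<le> 1 \<Longrightarrow> c *\<^sub>R x \<in> body"
proof -
  assume "x \<in> body" "\<bar>c\<bar> \<le> 1"
  have "\<bar>c\<bar> *\<^sub>R y \<in> body" if "y \<in> body" for y
    using convexD[OF convex_body that zero_in_body, of "\<bar>c\<bar>" "1 - \<bar>c\<bar>"] \<open>\<bar>c\<bar> \<le> 1\<close> by simp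
  from this[of x] this[of "- x"] show ?thesis
    using \<open>x \<in> body\<close> uminus_body by (cases "0 \<le> c") auto
qed

lemma scaleR_body_mono:
  assumes "x \<in> (*\<^sub>R) d ` body" "0 \<le> d" "d \<le> d'"
  shows "x \<in> (*\<^sub>R) d' ` body"
proof (cases "d' = 0")
  case True
  then show ?thesis using assms by simp
next
  case False
  obtain y where y: "y \<in> body" "x = d *\<^sub>R y"
    using assms(1) by blast
  then have "x = d' *\<^sub>R ((d / d') *\<^sub>R y)"
    using False by simp
  then show ?thesis
    using scaleR_body[OF y(1), of "d / d'"] assms(2,3) False
    by (intro image_eqI[of _ _ "(d / d') *\<^sub>R y"]) simp_all
qed

lemma scaleR_body_interior:
  assumes "x \<in> body" "\<bar>c\<bar> < 1"
  shows "c *\<^sub>R x \<in> interior body"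
proof -
  have shrink: "d *\<^sub>R y \<in> interior body" if "y \<in> body" "0 \<le> d" "d < 1" for y d
  proof -
    have "y - (1 - d) *\<^sub>R (y - 0) \<in> interior body"
      using that zero_in_interior_body convex_body by (intro mem_interior_convex_shrink) auto
    then show ?thesis
      by (simp add: algebra_simps)
  qed
  show ?thesis
    using shrink[of x "\<bar>c\<bar>"] shrink[of "- x" "\<bar>c\<bar>"] assms uminus_body by (cases "0 \<le> c") auto
qed

text \<open>
  Together with \<open>scaleR_body_interior\<close>, this describes interior points as those of gauge less than
  \<open>1\<close>. In this form they are visibly preserved by products, although these need not be open
  maps.
\<close>

lemma interior_body_scaleR:
  assumes "x \<in> interior body"
  obtains d where "0 \<le> d" "d < 1" "x \<in> (*\<^sub>R) d ` body"
proof -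
  obtain e where e: "0 < e" "cball x e \<subseteq> body"
    using assms unfolding mem_interior_cball by blast
  \<comment> \<open>Stretching \<open>x\<close> by \<open>1 + s\<close> moves it by at most \<open>e\<close>.\<close>
  define s where "s = e / (norm x + 1)"
  have s: "0 < s" "s * norm x \<le> e"
    using e(1) by (simp_all add: s_def field_simps add_pos_nonneg)
  have "(1 + s) *\<^sub>R x \<in> cball x e"
    using s by (simp add: dist_norm algebra_simps)
  moreover have "x = (1 / (1 + s)) *\<^sub>R ((1 + s) *\<^sub>R x)"
    using s by simp
  ultimately have "x \<in> (*\<^sub>R) (1 / (1 + s)) ` body"
    using e(2) by blast
  then show thesis
    using s(1) by (intro that[of "1 / (1 + s)"]) auto
qed

lemma scaled_body_mult:
  assumes "set w \<subseteq> N" "x \<in> (*\<^sub>R) d ` body"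
  shows "mat_prod w *v x \<in> (*\<^sub>R) d ` body"
  using assms body_mult by (auto simp: matrix_vector_mult_scaleR)

lemma interior_body_mult:
  assumes "set w \<subseteq> N" "x \<in> interior body"
  shows "mat_prod w *v x \<in> interior body"
proof -
  obtain d where d: "0 \<le> d" "d < 1" "x \<in> (*\<^sub>R) d ` body"
    using interior_body_scaleR[OF assms(2)] by blast
  then obtain y where "y \<in> body" "mat_prod w *v x = d *\<^sub>R y"
    using scaled_body_mult[OF assms(1) d(3)] by blast
  then show ?thesis
    using d scaleR_body_interior by simp
qed

lemma finite_interior_body_scaleR:
  assumes "finite F" "F \<subseteq> interior body"
  shows "\<exists>d. 0 \<le> d \<and> d < 1 \<and> F \<subseteq> (*\<^sub>R) d ` body"
  using assms
proof (induction F rule: finite_induct)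
  case empty
  then show ?case by (auto intro: exI[of _ 0])
next
  case (insert x F)
  obtain d where d: "0 \<le> d" "d < 1" "F \<subseteq> (*\<^sub>R) d ` body"
    using insert by auto
  obtain d' where d': "0 \<le> d'" "d' < 1" "x \<in> (*\<^sub>R) d' ` body"
    using interior_body_scaleR[of x] insert.prems by auto
  have "y \<in> (*\<^sub>R) (max d d') ` body" if "y \<in> insert x F" for y
  proof (cases "y = x")
    case True
    then show ?thesis
      using d'(1) scaleR_body_mono[OF d'(3), of "max d d'"] by simp
  next
    case False
    then have "y \<in> (*\<^sub>R) d ` body"
      using d(3) that by blast
    then show ?thesis
      using d(1) by (rule scaleR_body_mono) simp
  qed
  then show ?case
    using d d' by (intro exI[of _ "max d d'"]) (simp add: subsetI)
qed

text \<open>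
  The points visited by a long word, read from the right, all lie in the body, so two of them are close:
  \<open>a\<close> is the part of the word that leads to the first of them, and \<open>q\<close> leads on to the second.
  None of these points is interior, since otherwise the endpoint would be interior too.
\<close>

lemma approximate_return:
  assumes y: "y \<in> body"
    and stay: "\<And>L. \<exists>w. set w \<subseteq> N \<and> length w = L \<and> mat_prod w *v y \<notin> interior body"
    and e: "0 < e"
  shows "\<exists>a q. set a \<subseteq> N \<and> set q \<subseteq> N \<and> q \<noteq> [] \<and> mat_prod a *v y \<notin> interior body
    \<and> dist (mat_prod q *v (mat_prod a *v y)) (mat_prod a *v y) < e"
proof -
  obtain L :: nat where L: "\<And>x. (\<And>i. i \<le> L \<Longrightarrow> x i \<in> body)
      \<Longrightarrow> \<exists>i j. i < j \<and> j \<le> L \<and> dist (x i) (x j) < e"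
    using compact_recurrence[OF compact_body e] by blast
  obtain w where w: "set w \<subseteq> N" "length w = L" "mat_prod w *v y \<notin> interior body"
    using stay by blast
  define x where "x i = mat_prod (drop i w) *v y" for i
  have drop_N: "set (drop i w) \<subseteq> N" for i
    using w(1) set_drop_subset by fast
  have "x i \<in> body" for i
    unfolding x_def using drop_N y by (rule body_mult)
  then obtain i j where ij: "i < j" "j \<le> L" "dist (x i) (x j) < e"
    using L[of x] by blast
  define q where "q = take (j - i) (drop i w)"
  have "drop i w = q @ drop j w"
    using ij(1) by (metis q_def append_take_drop_id drop_drop le_add_diff_inverse2 less_imp_le)
  then have "x i = mat_prod q *v x j"
    by (simp add: x_def mat_prod_append matrix_vector_mul_assoc)
  moreover have "x j \<notin> interior body"
  proof
    assume "x j \<in> interior body"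
    moreover have "mat_prod w *v y = mat_prod (take j w) *v x j"
      unfolding x_def matrix_vector_mul_assoc mat_prod_append[symmetric] by simp
    moreover have "set (take j w) \<subseteq> N"
      using w(1) set_take_subset by fast
    ultimately show False
      using w(3) interior_body_mult by simp
  qed
  moreover have "set q \<subseteq> N"
    unfolding q_def using drop_N[of i] set_take_subset by fast
  moreover have "q \<noteq> []"
    using ij w(2) by (simp add: q_def)
  ultimately show ?thesis
    using drop_N[of j] ij(3) unfolding x_def by metis
qed

text \<open>
  The products are bounded, so approximate returns of ever better quality have a convergent
  subsequence.
\<close>

lemma limit_return:
  assumes y: "y \<in> body"
    and stay: "\<And>L. \<exists>w. set w \<subseteq> N \<and> length w = L \<and> mat_prod w *v y \<notin> interior body"
  obtains P Q where "P \<in> closure (products N)" "Q \<in> closure (nonempty_products N)"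
    "P *v y \<notin> interior body" "Q *v (P *v y) = P *v y"
proof -
  have "\<forall>n. \<exists>a q. set a \<subseteq> N \<and> set q \<subseteq> N \<and> q \<noteq> [] \<and> mat_prod a *v y \<notin> interior body
    \<and> dist (mat_prod q *v (mat_prod a *v y)) (mat_prod a *v y) < inverse (real (Suc n))"
    using approximate_return[OF y stay] by simp
  then obtain a q where aq: "\<And>n. set (a n) \<subseteq> N" "\<And>n. set (q n) \<subseteq> N" "\<And>n. q n \<noteq> []"
      "\<And>n. mat_prod (a n) *v y \<notin> interior body"
    and return: "\<And>n. dist (mat_prod (q n) *v (mat_prod (a n) *v y)) (mat_prod (a n) *v y)
        < inverse (real (Suc n))"
    by metis
  have P_in: "mat_prod (a n) \<in> products N" for n
    using aq(1) by (rule mat_prod_in_products)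
  have Q_in: "mat_prod (q n) \<in> nonempty_products N" for n
    using aq(2,3)[of n] unfolding nonempty_products_def by (auto simp: Suc_le_eq)
  have "compact (closure (products N) \<times> closure (products N))"
    using bounded_products by (intro compact_Times) (simp_all add: compact_closure)
  then have "seq_compact (closure (products N) \<times> closure (products N))"
    by (rule compact_imp_seq_compact)
  moreover have "\<forall>n. (mat_prod (a n), mat_prod (q n)) \<in> closure (products N) \<times> closure (products N)"
    using P_in Q_in closure_subset closure_nonempty_products_subset by fast
  ultimately obtain l \<sigma> where \<sigma>: "strict_mono (\<sigma> :: nat \<Rightarrow> nat)"
      and l: "((\<lambda>n. (mat_prod (a n), mat_prod (q n))) \<circ> \<sigma>) \<longlonglongrightarrow> l"
    by (rule seq_compactE)
  define P where "P = fst l"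
  define Q where "Q = snd l"
  have P: "(\<lambda>n. mat_prod (a (\<sigma> n))) \<longlonglongrightarrow> P"
    using tendsto_fst[OF l] by (simp add: P_def o_def)
  have Q: "(\<lambda>n. mat_prod (q (\<sigma> n))) \<longlonglongrightarrow> Q"
    using tendsto_snd[OF l] by (simp add: Q_def o_def)
  have Py: "(\<lambda>n. mat_prod (a (\<sigma> n)) *v y) \<longlonglongrightarrow> P *v y"
    by (intro tendsto_matrix_vector_mult P tendsto_const)
  have "(\<lambda>n. dist (mat_prod (q (\<sigma> n)) *v (mat_prod (a (\<sigma> n)) *v y)) (mat_prod (a (\<sigma> n)) *v y))
      \<longlonglongrightarrow> dist (Q *v (P *v y)) (P *v y)"
    by (intro tendsto_dist tendsto_matrix_vector_mult Q Py)
  moreover have "(\<lambda>n. dist (mat_prod (q (\<sigma> n)) *v (mat_prod (a (\<sigma> n)) *v y)) (mat_prod (a (\<sigma> n)) *v y))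
      \<longlonglongrightarrow> 0"
  proof (rule tendsto_sandwich[OF _ _ tendsto_const])
    show "(\<lambda>n. inverse (real (Suc (\<sigma> n)))) \<longlonglongrightarrow> 0"
      using LIMSEQ_subseq_LIMSEQ[OF LIMSEQ_inverse_real_of_nat \<sigma>] by (simp add: o_def)
    show "\<forall>\<^sub>F n in sequentially. dist (mat_prod (q (\<sigma> n)) *v (mat_prod (a (\<sigma> n)) *v y))
        (mat_prod (a (\<sigma> n)) *v y) \<le> inverse (real (Suc (\<sigma> n)))"
      by (intro always_eventually allI less_imp_le return)
  qed simp
  ultimately have "Q *v (P *v y) = P *v y"
    using LIMSEQ_unique by fastforce
  moreover have "P \<in> closure (products N)"
    unfolding closure_sequential using P P_in by (intro exI[of _ "\<lambda>n. mat_prod (a (\<sigma> n))"]) simp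
  moreover have "Q \<in> closure (nonempty_products N)"
    unfolding closure_sequential using Q Q_in by (intro exI[of _ "\<lambda>n. mat_prod (q (\<sigma> n))"]) simp
  moreover have "P *v y \<in> - interior body"
    by (rule closed_sequentially[OF _ _ Py]) (simp_all add: closed_Compl aq(4))
  ultimately show thesis
    using that by simp
qed

text \<open>
  If arbitrarily long words kept \<open>A *v g\<close> out of the interior, a limit \<open>P\<close> of products would send
  \<open>A *v g\<close> to a leading eigenvector, hence to a multiple of some \<open>h \<in> G\<close>. A word \<open>w\<close> leads from \<open>h\<close> back
  to \<open>g\<close>, and \<open>A\<close> from there to \<open>A *v g\<close>. So \<open>A *v g\<close> is an eigenvector of the limit product
  \<open>A ** mat_prod w ** P\<close>, with an eigenvalue that has modulus at least \<open>1\<close> because \<open>P *v (A *v g)\<close> is not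
  interior, and at most \<open>1\<close> by boundedness. This puts \<open>A *v g\<close> on a line through \<open>G\<close>.
\<close>

lemma eventually_interior:
  assumes A: "A \<in> N" and g: "g \<in> G" and off: "\<And>h. h \<in> G \<Longrightarrow> A *v g \<notin> span {h}"
  shows "\<exists>L. \<forall>w. set w \<subseteq> N \<and> length w = L \<longrightarrow> mat_prod w *v (A *v g) \<in> interior body"
proof (rule ccontr)
  let ?y = "A *v g"
  assume "\<nexists>L. \<forall>w. set w \<subseteq> N \<and> length w = L \<longrightarrow> mat_prod w *v ?y \<in> interior body"
  moreover have "?y \<in> body"
    using A g G_subset_orbit orbit_subset_body body_step by blast
  ultimately obtain P Q where P: "P \<in> closure (products N)" and Q: "Q \<in> closure (nonempty_products N)"
    and z: "P *v ?y \<notin> interior body" "Q *v (P *v ?y) = 1 *\<^sub>R (P *v ?y)"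
    using limit_return[of ?y] by (metis scaleR_one)
  have "P *v ?y \<noteq> 0"
    using z(1) zero_in_interior_body by metis
  then obtain h c where h: "h \<in> G" "P *v ?y = c *\<^sub>R h"
    using leading[OF Q _ z(2)] by (auto simp: span_singleton)
  have "h \<in> body"
    using h(1) G_subset_orbit orbit_subset_body by blast
  then have "1 \<le> \<bar>c\<bar>"
    using z(1) scaleR_body_interior[of h c] unfolding h(2) by linarith
  obtain w s where w: "set w \<subseteq> N" "\<bar>s\<bar> = 1" "mat_prod w *v h = s *\<^sub>R g"
    using connected[OF h(1) g] by blast
  let ?R = "mat_prod (A # w) ** P"
  have R: "?R \<in> closure (nonempty_products N)"
    using A w(1) by (intro nonempty_products_mult_closure P) auto
  have Ry: "?R *v ?y = (c * s) *\<^sub>R ?y"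
    by (simp add: h(2) w(3) matrix_vector_mult_scaleR flip: matrix_vector_mul_assoc)
  have "?y \<noteq> 0"
    using off[OF g] span_zero by metis
  moreover from this have "\<bar>c * s\<bar> \<le> 1"
    using real_eigenvalue_le_1_if_bounded_products[OF bounded_products _ _ Ry]
      subsetD[OF closure_nonempty_products_subset R] by simp
  then have "\<bar>c * s\<bar> = 1"
    using \<open>1 \<le> \<bar>c\<bar>\<close> w(2) by (simp add: abs_mult)
  ultimately have "\<exists>h\<in>G. ?y \<in> span {h}"
    using leading[OF R _ Ry] by simp
  then show False
    using off by blast
qed

text \<open>
  A word that leads from \<open>h\<close> back to \<open>g\<close> turns the step into a product with eigenvalue \<open>c\<close> or \<open>-c\<close>.
\<close>

lemma step_on_line_scalar_le_1:
  assumes "A \<in> N" "g \<in> G" "h \<in> G" "A *v g = c *\<^sub>R h"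
  shows "\<bar>c\<bar> \<le> 1"
proof -
  obtain w s where w: "set w \<subseteq> N" "\<bar>s\<bar> = 1" "mat_prod w *v h = s *\<^sub>R g"
    using connected[OF assms(3,2)] by blast
  have "mat_prod (w @ [A]) *v g = (c * s) *\<^sub>R g"
    by (simp add: mat_prod_append assms(4) w(3) matrix_vector_mult_scaleR
        flip: matrix_vector_mul_assoc)
  moreover have "mat_prod (w @ [A]) \<in> closure (products N)"
    using w(1) assms(1) closure_subset mat_prod_in_products[of "w @ [A]" N] by auto
  moreover have "g \<noteq> 0"
    using assms(2) zero_notin_G by blast
  ultimately have "\<bar>c * s\<bar> \<le> 1"
    by (intro real_eigenvalue_le_1_if_bounded_products[OF bounded_products])
  then show ?thesis
    using w(2) by (simp add: abs_mult)
qed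

text \<open>
  There are finitely many steps that leave the lines through \<open>G\<close>, and finitely many words of the
  length that \<open>eventually_interior\<close> provides for each of them. Finitely many interior points
  lie in a common shrunken copy of the body, and further letters keep them there.
\<close>

lemma uniform_shrinking:
  obtains L d where "0 \<le> d" "d < 1"
    "\<And>A g w. \<lbrakk>A \<in> N; g \<in> G; \<And>h. h \<in> G \<Longrightarrow> A *v g \<notin> span {h}; set w \<subseteq> N; L \<le> length w\<rbrakk>
      \<Longrightarrow> mat_prod w *v (A *v g) \<in> (*\<^sub>R) d ` body"
proof -
  define B where "B = {(A, g). A \<in> N \<and> g \<in> G \<and> (\<forall>h\<in>G. A *v g \<notin> span {h})}"
  have "B \<subseteq> N \<times> G"
    by (auto simp: B_def)
  then have "finite B"
    using finite_N finite_G finite_subset by blast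
  have "\<forall>b. \<exists>L. b \<in> B \<longrightarrow>
      (\<forall>w. set w \<subseteq> N \<and> length w = L \<longrightarrow> mat_prod w *v (fst b *v snd b) \<in> interior body)"
    using eventually_interior by (fastforce simp: B_def)
  then obtain l where l: "\<And>b w. b \<in> B \<Longrightarrow> set w \<subseteq> N \<Longrightarrow> length w = l b
      \<Longrightarrow> mat_prod w *v (fst b *v snd b) \<in> interior body"
    by metis
  define W where "W b = (\<lambda>w. mat_prod w *v (fst b *v snd b)) ` {w. set w \<subseteq> N \<and> length w = l b}" for b
  have "finite (\<Union>b\<in>B. W b)"
    using \<open>finite B\<close> finite_lists_length_eq[OF finite_N] by (auto simp: W_def)
  moreover have "(\<Union>b\<in>B. W b) \<subseteq> interior body"
    using l by (auto simp: W_def)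
  ultimately obtain d where d: "0 \<le> d" "d < 1" "(\<Union>b\<in>B. W b) \<subseteq> (*\<^sub>R) d ` body"
    using finite_interior_body_scaleR by blast
  show thesis
  proof (rule that[OF d(1,2)])
    fix A g w
    assume *: "A \<in> N" "g \<in> G" "\<And>h. h \<in> G \<Longrightarrow> A *v g \<notin> span {h}" "set w \<subseteq> N"
      and len: "(\<Sum>b\<in>B. l b) \<le> length w"
    have b: "(A, g) \<in> B"
      using * by (auto simp: B_def)
    then have "l (A, g) \<le> length w"
      using member_le_sum[of "(A, g)" B l] \<open>finite B\<close> len by simp
    define k where "k = length w - l (A, g)"
    have sets: "set (take k w) \<subseteq> N" "set (drop k w) \<subseteq> N"
      using *(4) set_take_subset set_drop_subset by fast+
    moreover have "length (drop k w) = l (A, g)"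
      using \<open>l (A, g) \<le> length w\<close> by (simp add: k_def)
    ultimately have "mat_prod (drop k w) *v (A *v g) \<in> W (A, g)"
      by (auto simp: W_def)
    then have "mat_prod (drop k w) *v (A *v g) \<in> (*\<^sub>R) d ` body"
      using b d(3) by blast
    then have "mat_prod (take k w) *v (mat_prod (drop k w) *v (A *v g)) \<in> (*\<^sub>R) d ` body"
      by (rule scaled_body_mult[OF sets(1)])
    then show "mat_prod w *v (A *v g) \<in> (*\<^sub>R) d ` body"
      unfolding matrix_vector_mul_assoc[of "mat_prod (take k w)"] mat_prod_append[symmetric] by simp
  qed
qed

text \<open>
  Induction on the word, from its right end: the letter that acts first either stays on a line through \<open>G\<close>, where
  a factor of modulus at most \<open>1\<close> splits off and a shorter word remains, or it leaves these
  lines, and then the word is short or its value is in the shrunken body.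
\<close>

lemma orbit_cover:
  obtains Y d where "finite Y" "Y \<subseteq> body" "0 \<le> d" "d < 1"
    "orbit \<subseteq> {c *\<^sub>R y | c y. \<bar>c\<bar> \<le> 1 \<and> y \<in> Y} \<union> (*\<^sub>R) d ` body"
proof -
  obtain L d where d: "0 \<le> d" "d < 1"
    and shrink: "\<And>A g w. \<lbrakk>A \<in> N; g \<in> G; \<And>h. h \<in> G \<Longrightarrow> A *v g \<notin> span {h}; set w \<subseteq> N; L \<le> length w\<rbrakk>
      \<Longrightarrow> mat_prod w *v (A *v g) \<in> (*\<^sub>R) d ` body"
    by (rule uniform_shrinking) blast
  define Y where "Y = (\<lambda>(w, g). mat_prod w *v g) ` ({w. set w \<subseteq> N \<and> length w \<le> L} \<times> G)"
  have Y: "mat_prod w *v g \<in> Y" if "set w \<subseteq> N" "length w \<le> L" "g \<in> G" for w g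
    using that by (auto simp: Y_def)
  let ?C = "{c *\<^sub>R y | c y. \<bar>c\<bar> \<le> 1 \<and> y \<in> Y} \<union> (*\<^sub>R) d ` body"
  have cover_scaleR: "c *\<^sub>R x \<in> ?C" if "\<bar>c\<bar> \<le> 1" "x \<in> ?C" for c x
    using that(2)
  proof
    assume "x \<in> {c *\<^sub>R y | c y. \<bar>c\<bar> \<le> 1 \<and> y \<in> Y}"
    then obtain b y where "\<bar>b\<bar> \<le> 1" "y \<in> Y" "x = b *\<^sub>R y"
      by blast
    moreover have "\<bar>c * b\<bar> \<le> 1"
      using that(1) \<open>\<bar>b\<bar> \<le> 1\<close> by (simp add: abs_mult mult_le_one)
    ultimately show ?thesis
      by (metis (mono_tags, lifting) UnI1 mem_Collect_eq scaleR_scaleR)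
  next
    assume "x \<in> (*\<^sub>R) d ` body"
    then obtain y where "y \<in> body" "x = d *\<^sub>R y"
      by blast
    then have "c *\<^sub>R x = d *\<^sub>R (c *\<^sub>R y)" "c *\<^sub>R y \<in> body"
      using that(1) scaleR_body by (simp_all add: mult.commute)
    then show ?thesis
      by blast
  qed
  have "\<forall>g\<in>G. mat_prod w *v g \<in> ?C" if "set w \<subseteq> N" for w
    using that
  proof (induction w rule: rev_induct)
    case Nil
    have "g = 1 *\<^sub>R (mat_prod [] *v g)" for g :: "real^'n"
      by simp
    then show ?case
      using Y[of "[]"] by (fastforce)
  next
    case (snoc A w)
    have sets: "set w \<subseteq> N" "A \<in> N"
      using snoc.prems by auto
    show ?case
    proof
      fix g assume g: "g \<in> G"
      have split: "mat_prod (w @ [A]) *v g = mat_prod w *v (A *v g)"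
        by (simp add: mat_prod_append matrix_vector_mul_assoc)
      consider (line) h where "h \<in> G" "A *v g \<in> span {h}"
        | (long) "\<And>h. h \<in> G \<Longrightarrow> A *v g \<notin> span {h}" "L \<le> length w"
        | (short) "length (w @ [A]) \<le> L"
        by fastforce
      then show "mat_prod (w @ [A]) *v g \<in> ?C"
      proof cases
        case line
        then obtain c where c: "A *v g = c *\<^sub>R h"
          by (auto simp: span_singleton)
        then have "\<bar>c\<bar> \<le> 1"
          using step_on_line_scalar_le_1 sets(2) g line(1) by blast
        moreover have "mat_prod w *v h \<in> ?C"
          using snoc.IH[OF sets(1)] line(1) by blast
        ultimately have "c *\<^sub>R (mat_prod w *v h) \<in> ?C"
          by (rule cover_scaleR)
        then show ?thesis
          unfolding split c matrix_vector_mult_scaleR .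
      next
        case long
        then have "mat_prod w *v (A *v g) \<in> (*\<^sub>R) d ` body"
          using shrink sets g by blast
        then show ?thesis
          unfolding split by blast
      next
        case short
        have "mat_prod (w @ [A]) *v g = 1 *\<^sub>R (mat_prod (w @ [A]) *v g)"
          by simp
        then show ?thesis
          using Y[OF snoc.prems short g] by fastforce
      qed
    qed
  qed
  then have "orbit \<subseteq> ?C"
    by (auto simp: orbit_def)
  moreover have "finite Y"
    unfolding Y_def using finite_lists_length_le[OF finite_N] finite_G by blast
  moreover have "Y \<subseteq> body"
    unfolding Y_def using body_mult G_subset_orbit orbit_subset_body by fast
  ultimately show thesis
    using that d by blast
qed

text \<open>
  The cover of the orbit is closed and symmetric, so it contains the closure whose convex hull is the
  body, hence all extreme points. An extreme point is not interior, which rules out the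
  shrunken body and all factors of modulus less than \<open>1\<close>.
\<close>

lemma finite_extreme_points_body: "finite {x. x extreme_point_of body}"
proof -
  obtain Y d where Y: "finite Y" "Y \<subseteq> body" and d: "0 \<le> d" "d < 1"
    and cover: "orbit \<subseteq> {c *\<^sub>R y | c y. \<bar>c\<bar> \<le> 1 \<and> y \<in> Y} \<union> (*\<^sub>R) d ` body"
    by (rule orbit_cover)
  \<comment> \<open>Multiples by a compact set of factors, so that the cover is visibly closed.\<close>
  let ?S = "{c *\<^sub>R y | c y. c \<in> {-1..1} \<and> y \<in> Y}"
  let ?C = "?S \<union> (*\<^sub>R) d ` body"
  have "?S = (\<lambda>(c, y). c *\<^sub>R y) ` ({-1..1} \<times> Y)"
    by (fastforce simp: image_iff)
  moreover have "compact ((\<lambda>(c, y). c *\<^sub>R y) ` ({-1..1::real} \<times> Y))"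
    using finite_imp_compact[OF Y(1)] unfolding case_prod_beta
    by (intro compact_continuous_image compact_Times continuous_intros compact_Icc)
  ultimately have "compact ?S"
    by simp
  then have "closed ?C"
    using compact_body by (intro closed_Un compact_imp_closed compact_scaling)
  moreover have "orbit \<subseteq> ?C"
  proof -
    have "\<bar>c\<bar> \<le> 1 \<longleftrightarrow> c \<in> {-1..1}" for c :: real
      by (auto simp: abs_le_iff)
    then show ?thesis
      using cover by (simp only:)
  qed
  moreover have "uminus ` orbit \<subseteq> ?C"
  proof
    fix x assume "x \<in> uminus ` orbit"
    then have "- x \<in> ?C"
      using \<open>orbit \<subseteq> ?C\<close> by auto
    then show "x \<in> ?C"
    proof
      assume "- x \<in> ?S"
      then obtain c y where "c \<in> {-1..1}" "y \<in> Y" "x = (- c) *\<^sub>R y"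
        by (auto simp: minus_equation_iff[of x])
      then show ?thesis
        by (intro UnI1 CollectI exI[of _ "- c"] exI[of _ y]) auto
    next
      assume "- x \<in> (*\<^sub>R) d ` body"
      then obtain y where "y \<in> body" "x = d *\<^sub>R (- y)"
        by (auto simp: minus_equation_iff[of x])
      then show ?thesis
        using uminus_body by blast
    qed
  qed
  ultimately have "closure (orbit \<union> uminus ` orbit) \<subseteq> ?C"
    by (intro closure_minimal) auto
  moreover have "x \<in> closure (orbit \<union> uminus ` orbit)" "x \<notin> interior body"
    if "x extreme_point_of body" for x
    using that extreme_point_of_convex_hull extreme_point_not_in_interior
    unfolding body_def by blast+
  ultimately have "x \<in> Y \<union> uminus ` Y" if x: "x extreme_point_of body" for x
  proof -
    have int: "x \<notin> interior body" and "x \<in> ?C"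
      using x \<open>closure (orbit \<union> uminus ` orbit) \<subseteq> ?C\<close>
        \<open>\<And>x. x extreme_point_of body \<Longrightarrow> x \<in> closure (orbit \<union> uminus ` orbit)\<close>
        \<open>\<And>x. x extreme_point_of body \<Longrightarrow> x \<notin> interior body\<close> by blast+
    from \<open>x \<in> ?C\<close> show ?thesis
    proof
      assume "x \<in> ?S"
      then obtain c y where c: "c \<in> {-1..1}" "y \<in> Y" "x = c *\<^sub>R y"
        by blast
      then have "\<not> \<bar>c\<bar> < 1"
        using int scaleR_body_interior Y(2) by blast
      then have "c = 1 \<or> c = -1"
        using c(1) by auto
      then show ?thesis
        using c(2,3) by auto
    next
      assume "x \<in> (*\<^sub>R) d ` body"
      then show ?thesis
        using int scaleR_body_interior d by auto
    qed
  qed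
  then have "{x. x extreme_point_of body} \<subseteq> Y \<union> uminus ` Y"
    by blast
  then show ?thesis
    by (rule finite_subset) (simp add: Y(1))
qed

theorem invariant_polytope:
  obtains Z where "finite Z" "0 \<notin> Z" "0 \<in> interior (convex hull Z)"
    "\<And>A z. A \<in> N \<Longrightarrow> z \<in> Z \<Longrightarrow> A *v z \<in> convex hull Z"
proof
  let ?Z = "{x. x extreme_point_of body}"
  \<comment> \<open>Krein-Milman: the body is the polytope spanned by its extreme points.\<close>
  have hull: "convex hull ?Z = body"
    using Krein_Milman_Minkowski[OF compact_body convex_body] by simp
  show "finite ?Z"
    by (rule finite_extreme_points_body)
  show "0 \<in> interior (convex hull ?Z)"
    unfolding hull by (rule zero_in_interior_body)
  show "0 \<notin> ?Z"
    using zero_in_interior_body extreme_point_not_in_interior by blast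
  show "A *v z \<in> convex hull ?Z" if "A \<in> N" "z \<in> ?Z" for A z
    unfolding hull using that by (auto intro: body_step simp: extreme_point_of_def)
qed

end

section \<open>Conitopes over polytopes\<close>

definition outer_square :: "real^'n \<Rightarrow> real^'n^'n" where
  "outer_square x = (\<chi> i j. x $ i * x $ j)"

lemma outer_square_mult: "outer_square x *v y = (x \<bullet> y) *\<^sub>R x"
  by (simp add: vec_eq_iff outer_square_def matrix_vector_mult_def inner_vec_def sum_distrib_left
      mult_ac)

lemma inner_outer_square: "y \<bullet> (outer_square x *v y) = (x \<bullet> y)\<^sup>2"
  by (simp add: outer_square_mult power2_eq_square inner_commute)

lemma lift_op_outer_square: "lift_op A (outer_square x) = outer_square (A *v x)"
proof -
  have "lift_op A (outer_square x) *v y = outer_square (A *v x) *v y" for y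
    by (simp add: lift_op_def outer_square_mult dot_lmul_matrix matrix_vector_mult_scaleR
        matrix_vector_mul_assoc [symmetric] flip: inner_commute[of "A *v x"])
      (metis dot_lmul_matrix inner_commute transpose_matrix_vector)
  then show ?thesis
    by (simp add: matrix_eq)
qed

lemma outer_square_psd: "outer_square x \<in> psd_cone"
  by (simp add: psd_cone_def sym_matrices_def inner_outer_square)
    (simp add: vec_eq_iff outer_square_def transpose_def mult.commute)

lemma rank_outer_square:
  assumes "x \<noteq> 0"
  shows "rank (outer_square x) = 1"
proof -
  have "range ((*v) (outer_square x)) = span {x}"
  proof
    show "range ((*v) (outer_square x)) \<subseteq> span {x}"
      by (auto simp: outer_square_mult span_singleton)
    show "span {x} \<subseteq> range ((*v) (outer_square x))"
    proof
      fix y assume "y \<in> span {x}"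
      then obtain c where "y = c *\<^sub>R x"
        by (auto simp: span_singleton)
      then have "y = outer_square x *v ((c / (x \<bullet> x)) *\<^sub>R x)"
        using assms by (simp add: outer_square_mult)
      then show "y \<in> range ((*v) (outer_square x))"
        by blast
    qed
  qed
  then show ?thesis
    using assms by (simp add: rank_dim_range dim_singleton)
qed

lemma subspace_sym_matrices: "subspace sym_matrices"
  unfolding subspace_def sym_matrices_def by (auto simp: vec_eq_iff transpose_def)

lemma psd_add: "X \<in> psd_cone \<Longrightarrow> Y \<in> psd_cone \<Longrightarrow> X + Y \<in> psd_cone"
  using subspace_add[OF subspace_sym_matrices, of X Y]
  by (simp add: psd_cone_def matrix_vector_mult_add_rdistrib inner_add_right)

lemma psd_scaleR: "X \<in> psd_cone \<Longrightarrow> 0 \<le> c \<Longrightarrow> c *\<^sub>R X \<in> psd_cone"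
  using subspace_scale[OF subspace_sym_matrices, of X c]
  by (simp add: psd_cone_def flip: scaleR_matrix_vector_assoc)

lemma zero_psd: "0 \<in> psd_cone"
  using outer_square_psd[of 0] by (simp add: outer_square_def zero_vec_def)

lemma psd_le_refl: "psd_le X X"
  by (simp add: psd_le_def zero_psd)

lemma psd_le_trans: "psd_le X Y \<Longrightarrow> psd_le Y Z \<Longrightarrow> psd_le X Z"
  unfolding psd_le_def using psd_add by fastforce

lemma psd_le_convex_combination:
  assumes "psd_le X X'" "psd_le Y Y'" "0 \<le> a" "0 \<le> b"
  shows "psd_le (a *\<^sub>R X + b *\<^sub>R Y) (a *\<^sub>R X' + b *\<^sub>R Y')"
proof -
  have "a *\<^sub>R X' + b *\<^sub>R Y' - (a *\<^sub>R X + b *\<^sub>R Y) = a *\<^sub>R (X' - X) + b *\<^sub>R (Y' - Y)"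
    by (simp add: algebra_simps)
  then show ?thesis
    using assms unfolding psd_le_def by (metis psd_add psd_scaleR)
qed

lemma linear_lift_op: "linear (lift_op A)"
  unfolding lift_op_def
  by (intro linearI) (simp_all add: matrix_mult_scaleR_left matrix_mult_scaleR_right
      bounded_bilinear.add_left[OF bounded_bilinear_matrix_mult]
      bounded_bilinear.add_right[OF bounded_bilinear_matrix_mult])

lemma lift_op_sym: "X \<in> sym_matrices \<Longrightarrow> lift_op A X \<in> sym_matrices"
  by (simp add: sym_matrices_def lift_op_def matrix_transpose_mul matrix_mul_assoc)

lemma lift_op_psd:
  assumes "X \<in> psd_cone"
  shows "lift_op A X \<in> psd_cone"
proof -
  have "y \<bullet> (lift_op A X *v y) = (transpose A *v y) \<bullet> (X *v (transpose A *v y))" for y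
    by (simp add: lift_op_def dot_lmul_matrix flip: matrix_vector_mul_assoc)
  then show ?thesis
    using assms lift_op_sym[of X A] by (simp add: psd_cone_def)
qed

lemma lift_op_psd_le: "psd_le X Y \<Longrightarrow> psd_le (lift_op A X) (lift_op A Y)"
  unfolding psd_le_def by (metis lift_op_psd linear_diff linear_lift_op)

lemma lift_op_scaleR: "lift_op (c *\<^sub>R A) X = c\<^sup>2 *\<^sub>R lift_op A X"
proof -
  have "transpose (c *\<^sub>R A) = c *\<^sub>R transpose A"
    by (simp add: vec_eq_iff transpose_def)
  then show ?thesis
    by (simp add: lift_op_def matrix_mult_scaleR_left matrix_mult_scaleR_right power2_eq_square)
qed

lemma Coni_iff_hull:
  assumes "finite U"
  shows "X \<in> Coni U \<longleftrightarrow> X \<in> psd_cone \<and> (\<exists>p\<in>convex hull U. psd_le X p)"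
  unfolding Coni_def convex_hull_finite[OF assms] by auto

lemma convex_below_hull: "convex {X. \<exists>p\<in>convex hull U. psd_le X p}"
proof (rule convexI)
  fix X Y and a b :: real
  assume "X \<in> {X. \<exists>p\<in>convex hull U. psd_le X p}" "Y \<in> {X. \<exists>p\<in>convex hull U. psd_le X p}"
    and ab: "0 \<le> a" "0 \<le> b" "a + b = 1"
  then obtain p q where pq: "p \<in> convex hull U" "psd_le X p" "q \<in> convex hull U" "psd_le Y q"
    by blast
  then have "a *\<^sub>R p + b *\<^sub>R q \<in> convex hull U"
    using ab convexD[OF convex_convex_hull] by blast
  then show "a *\<^sub>R X + b *\<^sub>R Y \<in> {X. \<exists>p\<in>convex hull U. psd_le X p}"
    using psd_le_convex_combination[OF pq(2,4) ab(1,2)] by blast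
qed

lemma outer_square_convex:
  assumes "0 \<le> a" "0 \<le> b" "a + b = 1"
  shows "psd_le (outer_square (a *\<^sub>R x + b *\<^sub>R y)) (a *\<^sub>R outer_square x + b *\<^sub>R outer_square y)"
proof -
  have "a *\<^sub>R outer_square x + b *\<^sub>R outer_square y - outer_square (a *\<^sub>R x + b *\<^sub>R y)
      = (a * b) *\<^sub>R outer_square (x - y)"
  proof -
    have "a * (s * t) + b * (u * v) - (a * s + b * u) * (a * t + b * v)
        = a * b * ((s - u) * (t - v))" for s t u v
    proof -
      have b: "b = 1 - a"
        using assms(3) by simp
      show ?thesis
        by (simp add: b algebra_simps)
    qed
    then show ?thesis
      by (simp add: vec_eq_iff outer_square_def)
  qed
  then show ?thesis
    unfolding psd_le_def using assms(1,2) by (simp add: psd_scaleR outer_square_psd)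
qed

text \<open>
  Convexity of \<open>x \<mapsto> xx\<^sup>T\<close> in the semidefinite order makes the set of all \<open>x\<close> with the desired property
  convex.
\<close>

lemma outer_square_below_hull:
  assumes "x \<in> convex hull Z"
  shows "\<exists>p\<in>convex hull (outer_square ` Z). psd_le (outer_square x) p"
proof -
  let ?B = "{X. \<exists>p\<in>convex hull (outer_square ` Z). psd_le X p}"
  have "convex hull Z \<subseteq> {x. outer_square x \<in> ?B}"
  proof (rule hull_minimal)
    show "Z \<subseteq> {x. outer_square x \<in> ?B}"
    proof
      fix z assume "z \<in> Z"
      then have "outer_square z \<in> convex hull (outer_square ` Z)"
        by (simp add: hull_inc)
      then show "z \<in> {x. outer_square x \<in> ?B}"
        using psd_le_refl[of "outer_square z"] by blast
    qed
    show "convex {x. outer_square x \<in> ?B}"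
    proof (rule convexI)
      fix x y and a b :: real
      assume xy: "x \<in> {x. outer_square x \<in> ?B}" "y \<in> {x. outer_square x \<in> ?B}"
        and ab: "0 \<le> a" "0 \<le> b" "a + b = 1"
      then have "a *\<^sub>R outer_square x + b *\<^sub>R outer_square y \<in> ?B"
        by (intro convexD[OF convex_below_hull _ _ ab]) simp_all
      then obtain p where "p \<in> convex hull (outer_square ` Z)"
          "psd_le (a *\<^sub>R outer_square x + b *\<^sub>R outer_square y) p"
        by blast
      then show "a *\<^sub>R x + b *\<^sub>R y \<in> {x. outer_square x \<in> ?B}"
        using psd_le_trans[OF outer_square_convex[OF ab]] by blast
    qed
  qed
  then show ?thesis
    using assms by blast
qed

text \<open>
  The lifted map is linear and monotone, so it is enough to follow the vertices; the lift of a vertex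
  goes to the lift of a point of the polytope.
\<close>

lemma Coni_invariant_if_polytope_invariant:
  assumes "finite Z" and inv: "\<And>z. z \<in> Z \<Longrightarrow> A *v z \<in> convex hull Z"
    and X: "X \<in> Coni (outer_square ` Z)"
  shows "lift_op A X \<in> Coni (outer_square ` Z)"
proof -
  let ?U = "outer_square ` Z"
  obtain p where p: "p \<in> convex hull ?U" "psd_le X p"
    using X assms(1) by (auto simp: Coni_iff_hull)
  have "lift_op A ` (convex hull ?U) = convex hull (lift_op A ` ?U)"
    by (rule convex_hull_linear_image[OF linear_lift_op])
  also have "\<dots> \<subseteq> {X. \<exists>p\<in>convex hull ?U. psd_le X p}"
    using outer_square_below_hull[OF inv]
    by (intro hull_minimal convex_below_hull) (auto simp: lift_op_outer_square)
  finally obtain q where q: "q \<in> convex hull ?U" "psd_le (lift_op A p) q"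
    using p(1) by blast
  have "psd_le (lift_op A X) q"
    using lift_op_psd_le[OF p(2)] q(2) by (rule psd_le_trans)
  moreover have "lift_op A X \<in> psd_cone"
    using X assms(1) by (simp add: Coni_iff_hull lift_op_psd)
  ultimately show ?thesis
    using q(1) assms(1) by (auto simp: Coni_iff_hull)
qed

text \<open>
  On the unit sphere the quadratic form of \<open>p\<close> has a positive minimum \<open>m\<close>, and a symmetric matrix
  close to \<open>p\<close> changes the form by less than \<open>m\<close> there.
\<close>

lemma positive_definite_interior:
  assumes p: "p \<in> sym_matrices" and pd: "\<And>y. y \<noteq> 0 \<Longrightarrow> 0 < y \<bullet> (p *v y)"
  shows "p \<in> top_of_set sym_matrices interior_of psd_cone"
proof -
  have "continuous_on (sphere 0 1) (\<lambda>y. y \<bullet> (p *v y))"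
    by (intro continuous_intros linear_continuous_on) (simp add: linear_conv_bounded_linear [symmetric])
  moreover have "sphere 0 1 \<noteq> ({} :: (real^'a) set)"
    by simp
  ultimately obtain y0 :: "real^'a" where y0: "norm y0 = 1"
    and min: "\<And>y. norm y = 1 \<Longrightarrow> y0 \<bullet> (p *v y0) \<le> y \<bullet> (p *v y)"
    using continuous_attains_inf[of "sphere 0 1" "\<lambda>y. y \<bullet> (p *v y)"] by auto
  define m where "m = y0 \<bullet> (p *v y0)"
  have "0 < m"
    unfolding m_def using y0 by (intro pd) auto
  obtain K where K: "\<And>X y. norm ((X :: real^'a^'a) *v y) \<le> norm X * norm y * K" "0 < K"
    using bounded_bilinear.pos_bounded[OF bounded_bilinear_matrix_vector_mult] by blast
  have psd: "X \<in> psd_cone" if X: "X \<in> sym_matrices" "dist p X < m / K" for X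
  proof -
    have unit: "0 \<le> y \<bullet> (X *v y)" if "norm y = 1" for y
    proof -
      have "y \<bullet> ((p - X) *v y) \<le> norm ((p - X) *v y)"
        using norm_cauchy_schwarz[of y "(p - X) *v y"] that by simp
      also have "\<dots> \<le> norm (p - X) * K"
        using K(1)[of "p - X" y] that by simp
      also have "\<dots> \<le> m"
        using X(2) K(2) by (simp add: dist_norm pos_less_divide_eq)
      finally show ?thesis
        using min[OF that] by (simp add: m_def matrix_vector_mult_diff_rdistrib inner_diff_right)
    qed
    have "0 \<le> y \<bullet> (X *v y)" for y
    proof (cases "y = 0")
      case False
      define u where "u = y /\<^sub>R norm y"
      have "y = norm y *\<^sub>R u"
        using False by (simp add: u_def)
      then have "y \<bullet> (X *v y) = norm y * (norm y * (u \<bullet> (X *v u)))"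
        by (metis inner_scaleR_left inner_scaleR_right matrix_vector_mult_scaleR)
      moreover have "norm u = 1"
        using False by (simp add: u_def)
      ultimately show ?thesis
        using unit by simp
    qed simp
    then show ?thesis
      using X(1) by (simp add: psd_cone_def)
  qed
  have "openin (top_of_set sym_matrices) (sym_matrices \<inter> ball p (m / K))"
    by (simp add: openin_open_Int)
  moreover have "p \<in> sym_matrices \<inter> ball p (m / K)"
    using p \<open>0 < m\<close> K(2) by simp
  moreover have "sym_matrices \<inter> ball p (m / K) \<subseteq> psd_cone"
    using psd by auto
  ultimately show ?thesis
    unfolding interior_of_def by blast
qed

text \<open>
  The average of the lifted vertices is positive definite, because the vertices of a polytope with
  interior points are not all orthogonal to the same nonzero vector.
\<close>

lemma hull_outer_squares_meets_interior:
  assumes "finite Z" "0 \<in> interior (convex hull Z)"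
  shows "convex hull (outer_square ` Z) \<inter> (top_of_set sym_matrices interior_of psd_cone) \<noteq> {}"
proof -
  have Z: "Z \<noteq> {}"
    using assms(2) by auto
  define p where "p = (\<Sum>z\<in>Z. (1 / card Z) *\<^sub>R outer_square z)"
  have "p \<in> convex hull (outer_square ` Z)"
    unfolding p_def using assms(1) Z
    by (intro convex_sum) (auto intro: hull_inc)
  moreover have "p \<in> top_of_set sym_matrices interior_of psd_cone"
  proof (rule positive_definite_interior)
    show "p \<in> sym_matrices"
      unfolding p_def using outer_square_psd
      by (intro subspace_sum subspace_sym_matrices subspace_scale) (auto simp: psd_cone_def)
    fix y :: "real^'a" assume "y \<noteq> 0"
    have "\<exists>z\<in>Z. z \<bullet> y \<noteq> 0"
    proof (rule ccontr)
      assume "\<not> (\<exists>z\<in>Z. z \<bullet> y \<noteq> 0)"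
      then have "convex hull Z \<subseteq> {x. y \<bullet> x = 0}"
        by (intro hull_minimal convex_hyperplane) (auto simp: inner_commute)
      then have "interior (convex hull Z) \<subseteq> interior {x. y \<bullet> x = 0}"
        by (rule interior_mono)
      then show False
        using assms(2) interior_hyperplane[OF \<open>y \<noteq> 0\<close>] by auto
    qed
    then obtain z where z: "z \<in> Z" "z \<bullet> y \<noteq> 0"
      by blast
    have "y \<bullet> (p *v y) = (\<Sum>z\<in>Z. (z \<bullet> y)\<^sup>2 / card Z)"
      unfolding p_def bounded_bilinear.sum_left[OF bounded_bilinear_matrix_vector_mult]
      by (simp add: inner_sum_right inner_outer_square flip: scaleR_matrix_vector_assoc)
    moreover have "0 < real (card Z)"
      using Z assms(1) by (simp add: card_gt_0_iff)
    then have "0 < (\<Sum>z\<in>Z. (z \<bullet> y)\<^sup>2 / card Z)"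
      using z assms(1) by (intro sum_pos2[of _ z]) simp_all
    ultimately show "0 < y \<bullet> (p *v y)"
      by simp
  qed
  ultimately show ?thesis
    by blast
qed

text \<open>
  This makes the set whose infimum is the conitope norm nonempty; the infimum of the empty set would
  be an arbitrary number.
\<close>

lemma Coni_absorbing:
  assumes "finite U" and p: "p \<in> convex hull U" "p \<in> top_of_set sym_matrices interior_of psd_cone"
    and X: "X \<in> psd_cone"
  shows "\<exists>l>0. X /\<^sub>R l \<in> Coni U"
proof -
  obtain T where "openin (top_of_set sym_matrices) T" "p \<in> T" "T \<subseteq> psd_cone"
    using p(2) unfolding interior_of_def by blast
  then obtain e where e: "0 < e" "ball p e \<inter> sym_matrices \<subseteq> psd_cone" "p \<in> sym_matrices"
    unfolding openin_contains_ball by blast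
  \<comment> \<open>Small enough that \<open>p - t *\<^sub>R X\<close> stays within distance \<open>e\<close> of \<open>p\<close>.\<close>
  define t where "t = e / (2 * (norm X + 1))"
  have t: "0 < t" "t * norm X < e"
    using e(1) by (simp_all add: t_def field_simps add_pos_nonneg add_nonneg_pos)
  have "X \<in> sym_matrices"
    using X by (simp add: psd_cone_def)
  then have "p - t *\<^sub>R X \<in> sym_matrices"
    using e(3) by (intro subspace_diff subspace_scale subspace_sym_matrices)
  then have "psd_le (t *\<^sub>R X) p"
    using e(2) t by (auto simp: psd_le_def dist_norm)
  then have "t *\<^sub>R X \<in> Coni U"
    using assms(1) p(1) X t(1) by (auto simp: Coni_iff_hull psd_scaleR)
  then show ?thesis
    using t(1) by (intro exI[of _ "1 / t"]) simp
qed

lemma conitope_norm_le_if_scaled_invariant: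
  assumes "0 < c" and inv: "\<And>Y. Y \<in> Coni U \<Longrightarrow> f Y /\<^sub>R c \<in> Coni U"
    and f: "\<And>a. f (a *\<^sub>R X) = a *\<^sub>R f X"
    and nonempty: "\<exists>l>0. X /\<^sub>R l \<in> Coni U"
  shows "conitope_norm U (f X) \<le> c * conitope_norm U X"
proof -
  have "conitope_norm U (f X) / c \<le> l" if l: "l > 0" "X /\<^sub>R l \<in> Coni U" for l
  proof -
    have "f X /\<^sub>R (c * l) \<in> Coni U"
      using inv[OF l(2)] by (simp add: f mult.commute)
    moreover have "bdd_below {l. l > 0 \<and> f X /\<^sub>R l \<in> Coni U}"
      by (rule bdd_belowI[of _ 0]) auto
    ultimately have "conitope_norm U (f X) \<le> c * l"
      unfolding conitope_norm_def using \<open>0 < c\<close> l(1) by (intro cInf_lower) auto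
    then show ?thesis
      using \<open>0 < c\<close> by (simp add: field_simps)
  qed
  then have "conitope_norm U (f X) / c \<le> conitope_norm U X"
    unfolding conitope_norm_def[of U X] using nonempty by (intro cInf_greatest) auto
  then show ?thesis
    using \<open>0 < c\<close> by (simp add: field_simps)
qed

theorem extremal_conitope_if_invariant_polytope:
  assumes "finite Z" "0 \<in> interior (convex hull Z)"
    and inv: "\<And>A z. A \<in> M \<Longrightarrow> z \<in> Z \<Longrightarrow> (A /\<^sub>R r) *v z \<in> convex hull Z"
    and "0 < r" "jsr_on sym_matrices (lifted_set M) = r\<^sup>2"
  shows "extremal_conitope (lifted_set M) (outer_square ` Z)"
proof -
  let ?U = "outer_square ` Z"
  have fin: "finite ?U"
    using assms(1) by simp
  obtain p where p: "p \<in> convex hull ?U" "p \<in> top_of_set sym_matrices interior_of psd_cone"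
    using hull_outer_squares_meets_interior[OF assms(1,2)] by blast
  have "conitope_norm ?U (lift_op A X) \<le> r\<^sup>2 * conitope_norm ?U X"
    if "A \<in> M" "X \<in> psd_cone" for A X
  proof (rule conitope_norm_le_if_scaled_invariant)
    show "0 < r\<^sup>2"
      using \<open>0 < r\<close> by simp
    show "\<exists>l>0. X /\<^sub>R l \<in> Coni ?U"
      by (rule Coni_absorbing[OF fin p that(2)])
    show "lift_op A (a *\<^sub>R X) = a *\<^sub>R lift_op A X" for a
      by (rule linear_scale[OF linear_lift_op])
    show "lift_op A Y /\<^sub>R r\<^sup>2 \<in> Coni ?U" if "Y \<in> Coni ?U" for Y
      using Coni_invariant_if_polytope_invariant[OF assms(1) inv[OF \<open>A \<in> M\<close>] that]
      by (simp add: lift_op_scaleR power_inverse)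
  qed
  then show ?thesis
    using fin p assms(5) outer_square_psd unfolding extremal_conitope_def lifted_set_def by auto
qed

section \<open>Joint spectral radius of the lifted set\<close>

lemma list_over_image:
  assumes "set b \<subseteq> h ` A"
  obtains v where "set v \<subseteq> A" "b = map h v"
proof -
  have "b \<in> lists (h ` A)"
    using assms by (simp add: lists_eq_set)
  then have "b \<in> map h ` lists A"
    by (simp only: lists_image)
  then show thesis
    using that by (auto simp: lists_eq_set)
qed

lemma op_products_image:
  fixes h :: "real^'n^'n \<Rightarrow> 'b \<Rightarrow> 'b"
  assumes "h (mat 1) = id" "\<And>A B. h (A ** B) = h A \<circ> h B"
  shows "op_products k (h ` M) = {h (mat_prod w) | w. length w = k \<and> set w \<subseteq> M}"
proof -
  have h: "foldr (\<circ>) (map h w) id = h (mat_prod w)" for w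
    using assms by (induction w) (simp_all add: mat_prod_def)
  have "{v. length v = k \<and> set v \<subseteq> h ` M} = map h ` {w. length w = k \<and> set w \<subseteq> M}"
    by (auto 0 3 elim!: list_over_image)
  then have "op_products k (h ` M)
      = (\<lambda>v. foldr (\<circ>) v id) ` map h ` {w. length w = k \<and> set w \<subseteq> M}"
    unfolding op_products_def by blast
  also have "\<dots> = (\<lambda>w. h (mat_prod w)) ` {w. length w = k \<and> set w \<subseteq> M}"
    by (simp add: image_image h)
  finally show ?thesis
    by auto
qed

lemma op_products_lifted_set:
  "op_products k (lifted_set M) = {lift_op (mat_prod w) | w. length w = k \<and> set w \<subseteq> M}"
  unfolding lifted_set_def
  by (rule op_products_image)
    (auto simp: lift_op_def matrix_transpose_mul matrix_mul_assoc fun_eq_iff transpose_mat)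

lemma lift_op_norm_bound:
  obtains K where "K > 0" "\<And>B X :: real^'n^'n. norm (lift_op B X) \<le> K * (norm B)\<^sup>2 * norm X"
proof -
  obtain K where K: "\<And>(A :: real^'n^'n) (B :: real^'n^'n). norm (A ** B) \<le> norm A * norm B * K" "0 < K"
    using bounded_bilinear.pos_bounded[OF bounded_bilinear_matrix_mult] by blast
  have "linear (transpose :: real^'n^'n \<Rightarrow> real^'n^'n)"
    by (intro linearI) (simp_all add: vec_eq_iff transpose_def)
  then obtain T where T: "\<And>B :: real^'n^'n. norm (transpose B) \<le> norm B * T" "0 < T"
    using bounded_linear.pos_bounded unfolding linear_conv_bounded_linear by blast
  have "norm (lift_op B X) \<le> K\<^sup>2 * T * (norm B)\<^sup>2 * norm X" for B X :: "real^'n^'n"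
  proof -
    have "norm (lift_op B X) \<le> norm (B ** X) * norm (transpose B) * K"
      unfolding lift_op_def by (rule K(1))
    also have "\<dots> \<le> (norm B * norm X * K) * (norm B * T) * K"
      using K T by (intro mult_right_mono mult_mono) (auto intro: mult_nonneg_nonneg)
    finally show ?thesis
      by (simp add: power2_eq_square mult_ac)
  qed
  then show thesis
    using that[of "K\<^sup>2 * T"] K(2) T(2) by simp
qed

lemma norm_outer_square: "norm (outer_square x) = (norm x)\<^sup>2"
proof -
  have "inner (outer_square x) (outer_square x) = (x \<bullet> x)\<^sup>2"
    by (simp add: inner_vec_def outer_square_def power2_eq_square sum_product mult_ac)
  then show ?thesis
    by (simp add: norm_eq_sqrt_inner)
qed

lemma onorm_on_lift_op_le:
  assumes "\<And>X :: real^'n^'n. norm (lift_op B X) \<le> C * norm X" "0 \<le> C"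
  shows "onorm_on sym_matrices (lift_op B) \<le> C"
  unfolding onorm_on_def
proof (rule cSUP_least)
  show "sym_matrices \<noteq> {}"
    using subspace_0[OF subspace_sym_matrices] by blast
  show "norm (lift_op B X) / norm X \<le> C" for X
    using assms by (cases "X = 0") (simp_all add: pos_divide_le_eq)
qed

text \<open>
  Test vector: the lift of \<open>x\<close>, which is mapped to the lift of \<open>B *v x\<close>, and the norm of a lift is the
  square of the norm of the vector.
\<close>

lemma onorm_on_lift_op_ge:
  assumes "x \<noteq> 0"
  shows "(norm (B *v x) / norm x)\<^sup>2 \<le> onorm_on sym_matrices (lift_op B)"
proof -
  obtain K where K: "K > 0" "\<And>B X :: real^'a^'a. norm (lift_op B X) \<le> K * (norm B)\<^sup>2 * norm X"
    by (rule lift_op_norm_bound) blast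
  have "norm (lift_op B X) / norm X \<le> K * (norm B)\<^sup>2" for X
    using K by (cases "X = 0") (simp_all add: pos_divide_le_eq)
  then have "bdd_above ((\<lambda>X. norm (lift_op B X) / norm X) ` sym_matrices)"
    by (intro bdd_aboveI[of _ "K * (norm B)\<^sup>2"]) auto
  moreover have "outer_square x \<in> sym_matrices"
    using outer_square_psd[of x] by (simp add: psd_cone_def)
  ultimately have "norm (lift_op B (outer_square x)) / norm (outer_square x)
      \<le> onorm_on sym_matrices (lift_op B)"
    unfolding onorm_on_def by (rule cSUP_upper[rotated])
  then show ?thesis
    by (simp add: lift_op_outer_square norm_outer_square power_divide)
qed

lemma root_growth_limit:
  fixes f :: "nat \<Rightarrow> real"
  assumes "0 < c" "0 < C" "0 < r"
    and "\<And>k. 0 < k \<Longrightarrow> root k (c * r ^ k) \<le> f k"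
    and "\<And>k. 0 < k \<Longrightarrow> f k \<le> root k (C * r ^ k)"
  shows "f \<longlonglongrightarrow> r"
proof (rule tendsto_sandwich)
  have lim: "(\<lambda>k. root k a * r) \<longlonglongrightarrow> r" if "0 < a" for a
    using tendsto_mult[OF LIMSEQ_root_const[OF that] tendsto_const[of r]] by simp
  have root: "root k (a * r ^ k) = root k a * r" if "0 < k" for k a
    using that \<open>0 < r\<close> by (simp add: real_root_mult real_root_power_cancel)
  show "(\<lambda>k. root k c * r) \<longlonglongrightarrow> r" "(\<lambda>k. root k C * r) \<longlonglongrightarrow> r"
    using assms(1,2) lim by blast+
  show "\<forall>\<^sub>F k in sequentially. root k c * r \<le> f k"
    using eventually_gt_at_top[of 0] by eventually_elim (use assms(4) root in simp)
  show "\<forall>\<^sub>F k in sequentially. f k \<le> root k C * r"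
    using eventually_gt_at_top[of 0] by eventually_elim (use assms(5) root in simp)
qed

lemma mat_prod_concat_replicate:
  assumes "mat_prod w *v u = s *\<^sub>R u"
  shows "mat_prod (concat (replicate k w)) *v u = s ^ k *\<^sub>R u"
  by (induction k)
    (simp_all add: mat_prod_append assms matrix_vector_mult_scaleR mult.commute
      flip: matrix_vector_mul_assoc)

text \<open>
  A high power of \<open>w\<close> preserves the norm of \<open>u\<close>. Cut it into a prefix and a suffix of length \<open>k\<close>; since the
  prefix is bounded, the suffix cannot make \<open>u\<close> small.
\<close>

lemma word_of_every_length:
  assumes "bounded (products N)" "set w \<subseteq> N" "w \<noteq> []" "u \<noteq> 0"
    and "mat_prod w *v u = s *\<^sub>R u" "\<bar>s\<bar> = 1"
  obtains c where "0 < c"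
    "\<And>k. \<exists>b. set b \<subseteq> N \<and> length b = k \<and> c \<le> norm (mat_prod b *v u) / norm u"
proof -
  obtain B where B: "0 < B" "\<And>P. P \<in> products N \<Longrightarrow> norm P \<le> B"
    using assms(1) unfolding bounded_pos by blast
  obtain K where K: "\<And>P x. norm ((P :: real^'a^'a) *v x) \<le> norm P * norm x * K" "0 < K"
    using bounded_bilinear.pos_bounded[OF bounded_bilinear_matrix_vector_mult] by blast
  have "\<exists>b. set b \<subseteq> N \<and> length b = k \<and> 1 / (B * K) \<le> norm (mat_prod b *v u) / norm u" for k
  proof -
    define p where "p = concat (replicate k w)"
    have "length p = k * length w"
      by (simp add: p_def length_concat sum_list_replicate)
    moreover have "1 \<le> length w"
      using assms(3) by (simp add: Suc_le_eq)
    ultimately have len: "k \<le> length p"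
      by simp
    have "set p \<subseteq> N"
      using assms(2) by (auto simp: p_def)
    define a b where "a = take (length p - k) p" and "b = drop (length p - k) p"
    have ab: "p = a @ b" "length b = k" "set a \<subseteq> N" "set b \<subseteq> N"
      using len \<open>set p \<subseteq> N\<close> set_take_subset[of "length p - k" p] set_drop_subset[of "length p - k" p]
      by (auto simp: a_def b_def)
    have "mat_prod a *v (mat_prod b *v u) = s ^ k *\<^sub>R u"
      using mat_prod_concat_replicate[OF assms(5), of k] ab(1)
      by (simp add: p_def mat_prod_append matrix_vector_mul_assoc)
    then have "norm u = norm (mat_prod a *v (mat_prod b *v u))"
      using assms(6) by (simp add: power_abs)
    also have "\<dots> \<le> norm (mat_prod a) * norm (mat_prod b *v u) * K"
      by (rule K(1))
    also have "\<dots> \<le> B * norm (mat_prod b *v u) * K"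
      using B(2)[OF mat_prod_in_products[OF ab(3)]] K(2) by (intro mult_right_mono) auto
    finally have "1 / (B * K) \<le> norm (mat_prod b *v u) / norm u"
      using B(1) K(2) assms(4) by (simp add: field_simps)
    then show ?thesis
      using ab by blast
  qed
  then show thesis
    using that[of "1 / (B * K)"] B(1) K(2) by simp
qed

text \<open>
  Bounded normalized products give an upper bound of order \<open>r\<^sup>2\<^sup>k\<close> for the norms of the lifted
  products of length \<open>k\<close>. A normalized product with an eigenvalue of modulus \<open>1\<close> gives a lower bound
  of the same order for every \<open>k\<close>. This proves convergence as well, without which the
  \<^const>\<open>lim\<close> in the definition would have no determined value.
\<close>

theorem jsr_on_lifted_set:
  assumes "0 < r" and bdd: "bounded (products ((\<lambda>A. A /\<^sub>R r) ` M))"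
    and w: "set w \<subseteq> (\<lambda>A. A /\<^sub>R r) ` M" "w \<noteq> []" "u \<noteq> 0" "mat_prod w *v u = s *\<^sub>R u" "\<bar>s\<bar> = 1"
  shows "jsr_on sym_matrices (lifted_set M) = r\<^sup>2"
proof -
  let ?n = "\<lambda>A. A /\<^sub>R r"
  let ?on = "\<lambda>P. onorm_on sym_matrices (lift_op P)"
  define W where "W k = {w. length w = k \<and> set w \<subseteq> M}" for k
  obtain K where K: "K > 0" "\<And>B X :: real^'a^'a. norm (lift_op B X) \<le> K * (norm B)\<^sup>2 * norm X"
    by (rule lift_op_norm_bound) blast
  obtain B where B: "0 < B" "\<And>P. P \<in> products (?n ` M) \<Longrightarrow> norm P \<le> B"
    using bdd unfolding bounded_pos by blast
  obtain c where c: "0 < c"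
      "\<And>k. \<exists>b. set b \<subseteq> ?n ` M \<and> length b = k \<and> c \<le> norm (mat_prod b *v u) / norm u"
    by (rule word_of_every_length[OF bdd w]) blast
  have scaled: "mat_prod v = r ^ length v *\<^sub>R mat_prod (map ?n v)" for v
    using \<open>0 < r\<close> by (simp add: mat_prod_map_scaleR)
  have upper: "?on (mat_prod v) \<le> K * B\<^sup>2 * (r\<^sup>2) ^ k" if "v \<in> W k" for v k
  proof (rule onorm_on_lift_op_le)
    have "set (map ?n v) \<subseteq> ?n ` M"
      using that by (auto simp: W_def)
    then have "norm (mat_prod (map ?n v)) \<le> B"
      using B(2) mat_prod_in_products by blast
    then have "norm (mat_prod v) \<le> B * r ^ k"
      using that \<open>0 < r\<close> unfolding scaled[of v] by (simp add: W_def mult.commute)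
    then have "(norm (mat_prod v))\<^sup>2 \<le> B\<^sup>2 * (r\<^sup>2) ^ k"
      using power_mono[of _ "B * r ^ k" 2] by (simp add: power_mult_distrib flip: power_mult)
        (simp add: mult.commute)
    then have "K * (norm (mat_prod v))\<^sup>2 \<le> K * B\<^sup>2 * (r\<^sup>2) ^ k"
      using K(1) by (simp add: mult.assoc)
    then show "norm (lift_op (mat_prod v) X) \<le> K * B\<^sup>2 * (r\<^sup>2) ^ k * norm X" for X
      using K(2)[of "mat_prod v" X] by (meson mult_right_mono norm_ge_zero order_trans)
    show "0 \<le> K * B\<^sup>2 * (r\<^sup>2) ^ k"
      using K(1) by simp
  qed
  have lower: "\<exists>v\<in>W k. c\<^sup>2 * (r\<^sup>2) ^ k \<le> ?on (mat_prod v)" for k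
  proof -
    obtain b where b: "set b \<subseteq> ?n ` M" "length b = k" "c \<le> norm (mat_prod b *v u) / norm u"
      using c(2) by blast
    obtain v where v: "set v \<subseteq> M" "b = map ?n v"
      using b(1) by (rule list_over_image)
    have "norm (mat_prod v *v u) / norm u = r ^ k * (norm (mat_prod b *v u) / norm u)"
      using \<open>0 < r\<close> b(2) v(2) unfolding scaled[of v]
      by (simp flip: scaleR_matrix_vector_assoc)
    then have "c * r ^ k \<le> norm (mat_prod v *v u) / norm u"
      using mult_left_mono[OF b(3), of "r ^ k"] \<open>0 < r\<close> by (metis less_imp_le mult.commute zero_le_power)
    then have "(c * r ^ k)\<^sup>2 \<le> ?on (mat_prod v)"
      using onorm_on_lift_op_ge[OF w(3), of "mat_prod v"] c(1) \<open>0 < r\<close>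
      by (meson order_trans power_mono mult_nonneg_nonneg less_imp_le zero_le_power)
    then have "c\<^sup>2 * (r\<^sup>2) ^ k \<le> ?on (mat_prod v)"
      by (simp add: power_mult_distrib mult.commute flip: power_mult)
    then show ?thesis
      using v b(2) by (auto simp: W_def)
  qed
  define f where "f k = (SUP v\<in>W k. root k (?on (mat_prod v)))" for k
  have "f \<longlonglongrightarrow> r\<^sup>2"
  proof (rule root_growth_limit)
    show "0 < c\<^sup>2" "0 < K * B\<^sup>2" "0 < r\<^sup>2"
      using c(1) K(1) B(1) \<open>0 < r\<close> by simp_all
    fix k :: nat assume "0 < k"
    have le: "root k (?on (mat_prod v)) \<le> root k (K * B\<^sup>2 * (r\<^sup>2) ^ k)" if "v \<in> W k" for v
      using upper[OF that] \<open>0 < k\<close> by simp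
    obtain v where v: "v \<in> W k" "c\<^sup>2 * (r\<^sup>2) ^ k \<le> ?on (mat_prod v)"
      using lower by blast
    have "root k (c\<^sup>2 * (r\<^sup>2) ^ k) \<le> root k (?on (mat_prod v))"
      using v(2) \<open>0 < k\<close> by simp
    also have "\<dots> \<le> f k"
      unfolding f_def using v(1) le by (intro cSUP_upper bdd_aboveI) auto
    finally show "root k (c\<^sup>2 * (r\<^sup>2) ^ k) \<le> f k" .
    show "f k \<le> root k (K * B\<^sup>2 * (r\<^sup>2) ^ k)"
      unfolding f_def using v(1) le by (intro cSUP_least) auto
  qed
  moreover have "(\<lambda>k. SUP g\<in>op_products k (lifted_set M). root k (onorm_on sym_matrices g)) = f"
  proof
    fix k
    have "op_products k (lifted_set M) = (\<lambda>v. lift_op (mat_prod v)) ` W k"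
      by (auto simp: op_products_lifted_set W_def)
    then show "(SUP g\<in>op_products k (lifted_set M). root k (onorm_on sym_matrices g)) = f k"
      by (simp add: f_def image_image)
  qed
  ultimately show ?thesis
    unfolding jsr_on_def by (simp add: limI)
qed

section \<open>The leading cycle of an asymptotically simple set\<close>

lemma complex_eigenvector_real:
  assumes "complex_eigenvector P \<mu> (complexify x)"
  shows "x \<noteq> 0" "P *v x = Re \<mu> *\<^sub>R x" "\<bar>Re \<mu>\<bar> = cmod \<mu>"
proof -
  have eq: "of_real ((P *v x) $ i) = \<mu> * of_real (x $ i)" for i
    using assms unfolding complex_eigenvector_def complexify_matrix_vector_mult
    by (metis complexify_nth vector_smult_component)
  show "x \<noteq> 0"
    using assms by (simp add: complex_eigenvector_def)
  then obtain i where i: "x $ i \<noteq> 0"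
    by (auto simp: vec_eq_iff)
  have re: "(P *v x) $ i = Re \<mu> * x $ i" for i
    using arg_cong[OF eq[of i], of Re] by simp
  then show "P *v x = Re \<mu> *\<^sub>R x"
    by (simp add: vec_eq_iff)
  have "Im \<mu> = 0"
    using arg_cong[OF eq[of i], of Im] i by simp
  then show "\<bar>Re \<mu>\<bar> = cmod \<mu>"
    by (simp add: cmod_def)
qed

lemma complexify_scaleD:
  assumes "complexify x = c *s complexify u"
  shows "x = Re c *\<^sub>R u"
proof -
  have "x $ i = Re c * u $ i" for i
    using arg_cong[OF assms, of "\<lambda>v. Re (v $ i)"] by simp
  then show ?thesis
    by (simp add: vec_eq_iff)
qed

text \<open>
  For a real matrix, the conjugate of a leading eigenvector is a leading eigenvector, so by uniqueness
  it is a multiple of the original. Scaled to have an entry \<open>1\<close>, the eigenvector equals its conjugate.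
\<close>

lemma real_leading_eigenvector_if_unique:
  assumes "leading_eigenvectors P = {c *s v | c. c \<noteq> 0}"
  obtains u where "u \<noteq> 0" "leading_eigenvectors P = {c *s complexify u | c. c \<noteq> 0}"
proof -
  have "1 *s v \<in> leading_eigenvectors P"
    unfolding assms by (intro CollectI exI[of _ 1]) simp
  then have "v \<noteq> 0"
    by (auto simp: leading_eigenvectors_def complex_eigenvector_def)
  then obtain i where i: "v $ i \<noteq> 0"
    by (auto simp: vec_eq_iff)
  define x where "x = (1 / v $ i) *s v"
  have v: "v = v $ i *s x"
    using i by (simp add: x_def)
  have xi: "x $ i = 1"
    using i by (simp add: x_def)
  have "x \<in> leading_eigenvectors P"
    unfolding assms x_def using i by auto
  then obtain \<mu> where \<mu>: "cmod \<mu> = spectral_radius P" "map_matrix complex_of_real P *v x = \<mu> *s x"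
      "x \<noteq> 0"
    by (auto simp: leading_eigenvectors_def complex_eigenvector_def)
  define y where "y = (\<chi> j. cnj (x $ j))"
  have "map_matrix complex_of_real P *v y = cnj \<mu> *s y"
  proof -
    have "(map_matrix complex_of_real P *v y) $ j = cnj ((map_matrix complex_of_real P *v x) $ j)" for j
      by (simp add: y_def matrix_vector_mult_def map_matrix_def)
    then show ?thesis
      unfolding \<mu>(2) by (simp add: vec_eq_iff y_def)
  qed
  moreover have "y $ i = 1"
    by (simp add: y_def xi)
  moreover from this have "y \<noteq> 0"
    by auto
  ultimately have "y \<in> leading_eigenvectors P"
    using \<mu>(1) by (auto simp: leading_eigenvectors_def complex_eigenvector_def)
  then obtain c where "y = c *s v"
    using assms by blast
  then have y: "y = (c * v $ i) *s x"
    using v by (metis vector_smult_assoc)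
  then have "c * v $ i = 1"
    using \<open>y $ i = 1\<close> xi by (metis mult.right_neutral vector_smult_component)
  then have "cnj (x $ j) = x $ j" for j
    using y by (metis y_def vec_lambda_beta vector_smult_lid)
  then have real: "x = complexify (\<chi> j. Re (x $ j))"
    by (simp add: vec_eq_iff complex_eq_iff)
  have "{c *s v | c. c \<noteq> 0} = {c *s x | c. c \<noteq> 0}"
  proof (intro equalityI subsetI)
    fix z assume "z \<in> {c *s v | c. c \<noteq> 0}"
    then obtain c where "c \<noteq> 0" "z = c *s v"
      by blast
    then show "z \<in> {c *s x | c. c \<noteq> 0}"
      using i v by (intro CollectI exI[of _ "c * v $ i"]) (metis mult_eq_0_iff vector_smult_assoc)
  next
    fix z assume "z \<in> {c *s x | c. c \<noteq> 0}"
    then obtain c where "c \<noteq> 0" "z = c *s x"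
      by blast
    then show "z \<in> {c *s v | c. c \<noteq> 0}"
      using i by (intro CollectI exI[of _ "c / v $ i"]) (simp add: x_def)
  qed
  moreover have "(\<chi> j. Re (x $ j)) \<noteq> 0"
    using real \<mu>(3) by (metis complexify_eq_0_iff)
  ultimately show thesis
    using that[of "\<chi> j. Re (x $ j)"] assms real by simp
qed

lemma irreducible_normalized:
  assumes "irreducible_set M" "0 < jsr M"
  shows "irreducible_set (normalized M)"
  unfolding irreducible_set_def
proof (intro allI impI)
  fix V assume V: "subspace V \<and> (\<forall>A\<in>normalized M. \<forall>x\<in>V. A *v x \<in> V)"
  have "A *v x \<in> V" if "A \<in> M" "x \<in> V" for A x
  proof -
    have "jsr M *\<^sub>R ((A /\<^sub>R jsr M) *v x) \<in> V"
      using V that by (intro subspace_scale) (auto simp: normalized_def)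
    then show ?thesis
      using assms(2) by (simp flip: scaleR_matrix_vector_assoc)
  qed
  then show "V = {0} \<or> V = UNIV"
    using V assms(1) unfolding irreducible_set_def by blast
qed

lemma eigenvalue_le_jsr_power:
  assumes "nondefective M" "set w \<subseteq> M" "complex_eigenvector (mat_prod w) \<mu> v"
  shows "cmod \<mu> \<le> jsr M ^ length w"
proof -
  let ?r = "jsr M ^ length w"
  have "0 < jsr M" and bdd: "bounded (products (normalized M))"
    using assms(1) by (simp_all add: nondefective_def products_def)
  then have r: "0 < ?r"
    by simp
  let ?w = "map (\<lambda>A. A /\<^sub>R jsr M) w"
  have "set ?w \<subseteq> normalized M"
    using assms(2) by (auto simp: normalized_def)
  then have "mat_prod ?w \<in> closure (products (normalized M))"
    using mat_prod_in_products closure_subset by blast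
  moreover have "complex_eigenvector (mat_prod ?w) (\<mu> / ?r) v"
  proof -
    have "map_matrix complex_of_real (mat_prod w /\<^sub>R ?r) *v v
        = (1 / of_real ?r) *s (map_matrix complex_of_real (mat_prod w) *v v)"
      using r by (simp add: vec_eq_iff matrix_vector_mult_def map_matrix_def sum_divide_distrib divide_simps)
    then show ?thesis
      using assms(3) by (simp add: complex_eigenvector_def mat_prod_map_scaleR)
  qed
  ultimately have "cmod (\<mu> / ?r) \<le> 1"
    by (rule eigenvalue_le_1_if_bounded_products[OF bdd])
  then show ?thesis
    using \<open>0 < jsr M\<close> by (simp add: norm_divide norm_power pos_divide_le_eq)
qed

text \<open>
  With \<open>w\<close> the spectrum-maximizing word and \<open>u\<close> its real leading eigenvector, \<open>G\<close> consists of the vectors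
  that the normalized suffixes of \<open>w\<close> produce from \<open>u\<close>. If \<open>w = XY\<close>, then \<open>X\<close> maps a leading
  eigenvector of the cyclic permutation \<open>YX\<close> to one of \<open>XY\<close>, that is, to a multiple of \<open>u\<close>, and \<open>Y\<close>
  maps it back to a multiple of itself. So the leading eigenvectors of \<open>YX\<close> lie on the line of
  \<open>Yu\<close>, a vector of \<open>G\<close> up to scaling.
\<close>

lemma asymptotically_simple_imp_leading_cycle:
  fixes M :: "(real^'n^'n) set"
  assumes "finite M" "irreducible_set M" "asymptotically_simple M"
  obtains G w u s where "leading_cycle (normalized M) G" "set w \<subseteq> normalized M" "w \<noteq> []"
    "u \<noteq> 0" "mat_prod w *v u = s *\<^sub>R u" "\<bar>s\<bar> = 1"
proof -
  define r where "r = jsr M"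
  have nondef: "nondefective M"
    using assms(3) by (simp add: asymptotically_simple_def)
  then have r: "0 < r" and bdd: "bounded (products (normalized M))"
    by (simp_all add: nondefective_def products_def r_def)
  obtain w v where smp: "is_SMP M w"
    and unique: "leading_eigenvectors (mat_prod w) = {c *s v | c. c \<noteq> 0}"
    and leading: "set_leading_eigenvectors M
        = (\<Union>a<length w. leading_eigenvectors (mat_prod (rotate a w)))"
    using assms(3) unfolding asymptotically_simple_def is_minimal_SMP_def by blast
  define t where "t = length w"
  have w: "set w \<subseteq> M" "0 < t" and "root t (spectral_radius (mat_prod w)) = r"
    using smp by (auto simp: is_SMP_def t_def r_def)
  then have \<rho>: "spectral_radius (mat_prod w) = r ^ t"
    using r by (metis odd_real_root_pow real_root_pow_pos2 real_root_gt_0_iff less_imp_le)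
  obtain u where u: "u \<noteq> 0"
    and line: "leading_eigenvectors (mat_prod w) = {c *s complexify u | c. c \<noteq> 0}"
    by (rule real_leading_eigenvector_if_unique[OF unique])
  have "1 *s complexify u \<in> leading_eigenvectors (mat_prod w)"
    unfolding line by (intro CollectI exI[of _ 1]) simp
  then obtain \<mu> where "cmod \<mu> = r ^ t" "complex_eigenvector (mat_prod w) \<mu> (complexify u)"
    by (auto simp: leading_eigenvectors_def \<rho>)
  then obtain m where m: "mat_prod w *v u = m *\<^sub>R u" "\<bar>m\<bar> = r ^ t"
    using complex_eigenvector_real by metis
  define n where "n = map (\<lambda>A :: real^'n^'n. A /\<^sub>R r)"
  have n_N: "set (n x) \<subseteq> normalized M" if "set x \<subseteq> M" for x
    using that by (auto simp: n_def normalized_def r_def)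
  have n_prod: "mat_prod (n x) = mat_prod x /\<^sub>R r ^ length x" for x
    unfolding n_def by (rule mat_prod_map_scaleR)
  define s where "s = m / r ^ t"
  have "mat_prod (n w) *v u = s *\<^sub>R u"
    using m by (simp add: n_prod s_def t_def divide_inverse_commute flip: scaleR_matrix_vector_assoc)
  moreover have "\<bar>s\<bar> = 1"
    using m r by (simp add: s_def)
  ultimately have s: "mat_prod (n w) *v u = s *\<^sub>R u" "\<bar>s\<bar> = 1" .
  define g where "g a = mat_prod (n (drop a w)) *v u" for a
  have close: "mat_prod (n (take a w)) *v g a = s *\<^sub>R u" for a
    using s(1) unfolding g_def matrix_vector_mul_assoc mat_prod_append[symmetric]
    by (simp add: n_def flip: map_append)
  have g_nonzero: "g a \<noteq> 0" for a
    using close[of a] s(2) u by auto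
  have sets: "set (take a w) \<subseteq> M" "set (drop a w) \<subseteq> M" "set (rotate a w) \<subseteq> M" for a
    using w(1) set_take_subset set_drop_subset by fastforce+
  have "leading_cycle (normalized M) (g ` {..<t})"
  proof
    show "finite (normalized M)"
      using assms(1) by (simp add: normalized_def)
    show "irreducible_set (normalized M)"
      using irreducible_normalized assms(2) r by (simp add: r_def)
    show "g ` {..<t} \<noteq> {}" "0 \<notin> g ` {..<t}"
      using w(2) g_nonzero by (auto simp: image_iff)
  next
    fix p q assume "p \<in> g ` {..<t}" "q \<in> g ` {..<t}"
    then obtain a b where ab: "p = g a" "q = g b"
      by blast
    let ?x = "n (drop b w) @ n (take a w)"
    have "mat_prod ?x *v p = s *\<^sub>R q"
      unfolding mat_prod_append matrix_vector_mul_assoc[symmetric] ab close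
      by (simp add: g_def matrix_vector_mult_scaleR)
    moreover have "set ?x \<subseteq> normalized M"
      using n_N[OF sets(1)] n_N[OF sets(2)] by simp
    ultimately show "\<exists>x c. set x \<subseteq> normalized M \<and> \<bar>c\<bar> = 1 \<and> mat_prod x *v p = c *\<^sub>R q"
      using s(2) by blast
  next
    fix Q and x :: "real^'n" and c
    assume Q: "Q \<in> closure (nonempty_products (normalized M))"
      and x: "x \<noteq> 0" "Q *v x = c *\<^sub>R x" "\<bar>c\<bar> = 1"
    have ev: "complex_eigenvector Q (of_real c) (complexify x)"
      using x by (simp add: complex_eigenvector_complexify)
    have "spectral_radius Q = 1"
    proof (rule spectral_radius_eqI[OF ev])
      show "cmod (of_real c) = 1"
        using x(3) by simp
      show "cmod \<nu> \<le> 1" if "complex_eigenvector Q \<nu> v" for \<nu> v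
        using eigenvalue_le_1_if_bounded_products[OF bdd _ that] Q closure_nonempty_products_subset
        by blast
    qed
    moreover have "complexify x \<in> leading_eigenvectors Q"
      using ev x(3) calculation by (auto simp: leading_eigenvectors_def intro!: exI[of _ "of_real c"])
    moreover have "\<exists>X. (\<forall>j. X j \<in> nonempty_products (normalized M)) \<and> X \<longlonglongrightarrow> Q"
      using Q by (simp add: closure_sequential)
    ultimately have "complexify x \<in> set_leading_eigenvectors M"
      unfolding set_leading_eigenvectors_def by blast
    then obtain a where a: "a < t" "complexify x \<in> leading_eigenvectors (mat_prod (rotate a w))"
      using leading by (auto simp: t_def)
    define X Y where "X = mat_prod (take a w)" and "Y = mat_prod (drop a w)"
    have XY: "mat_prod w = X ** Y"
      unfolding X_def Y_def mat_prod_append[symmetric] by simp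
    \<comment> \<open>The eigenvector goes around the cycle: by \<open>X\<close> to the line of \<open>u\<close>, by \<open>Y\<close> back to itself.\<close>
    have YX: "mat_prod (rotate a w) = Y ** X"
      using a(1) by (simp add: X_def Y_def rotate_drop_take t_def mat_prod_append)
    have gY: "g a = Y *v u /\<^sub>R r ^ (t - a)"
      by (simp add: g_def n_prod Y_def t_def flip: scaleR_matrix_vector_assoc)
    have "spectral_radius (mat_prod (rotate a w)) = r ^ t"
    proof (rule spectral_radius_eqI)
      have "mat_prod (rotate a w) *v (Y *v u) = m *\<^sub>R (Y *v u)"
        using arg_cong[OF m(1), of "\<lambda>z. Y *v z"]
        by (simp add: YX XY matrix_vector_mul_assoc matrix_mul_assoc matrix_vector_mult_scaleR)
      moreover have "Y *v u \<noteq> 0"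
        using g_nonzero[of a] gY by auto
      ultimately show "complex_eigenvector (mat_prod (rotate a w)) (of_real m) (complexify (Y *v u))"
        by (simp add: complex_eigenvector_complexify)
      show "cmod (of_real m) = r ^ t"
        using m(2) by simp
      show "cmod \<nu> \<le> r ^ t" if "complex_eigenvector (mat_prod (rotate a w)) \<nu> v" for \<nu> v
        using eigenvalue_le_jsr_power[OF nondef sets(3) that] by (simp add: t_def r_def)
    qed
    then obtain \<nu> where "cmod \<nu> = r ^ t"
        "complex_eigenvector (mat_prod (rotate a w)) \<nu> (complexify x)"
      using a(2) by (auto simp: leading_eigenvectors_def)
    then obtain k where k: "(Y ** X) *v x = k *\<^sub>R x" "\<bar>k\<bar> = r ^ t"
      using complex_eigenvector_real unfolding YX by metis
    then have "k \<noteq> 0"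
      using r by auto
    have "mat_prod w *v (X *v x) = k *\<^sub>R (X *v x)"
      using arg_cong[OF k(1), of "\<lambda>z. X *v z"]
      by (simp add: XY matrix_vector_mul_assoc matrix_mul_assoc matrix_vector_mult_scaleR)
    moreover have "X *v x \<noteq> 0"
    proof
      assume "X *v x = 0"
      then have "k *\<^sub>R x = 0"
        using k(1) by (simp flip: matrix_vector_mul_assoc)
      then show False
        using \<open>k \<noteq> 0\<close> x(1) by simp
    qed
    ultimately have "complex_eigenvector (mat_prod w) (of_real k) (complexify (X *v x))"
      by (simp add: complex_eigenvector_complexify)
    then have "complexify (X *v x) \<in> leading_eigenvectors (mat_prod w)"
      using k(2) by (auto simp: leading_eigenvectors_def \<rho> intro!: exI[of _ "of_real k"])
    then obtain b where "X *v x = b *\<^sub>R u"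
      unfolding line using complexify_scaleD by blast
    then have "k *\<^sub>R x = b *\<^sub>R (Y *v u)"
      using k(1) by (simp add: matrix_vector_mult_scaleR flip: matrix_vector_mul_assoc)
    also have "\<dots> = (b * r ^ (t - a)) *\<^sub>R g a"
      using r by (simp add: gY)
    finally have "x = (b * r ^ (t - a) / k) *\<^sub>R g a"
      using \<open>k \<noteq> 0\<close> by (metis divide_inverse_commute eq_vector_fraction_iff scaleR_scaleR vector_fraction_eq_iff)
    then show "\<exists>h\<in>g ` {..<t}. x \<in> span {h}"
      using a(1) by (auto simp: span_singleton)
  qed (simp_all add: bdd)
  moreover have "n w \<noteq> []"
    using w(2) by (auto simp: n_def t_def)
  ultimately show thesis
    using that n_N[OF w(1)] u s by blast
qed

theorem theorem5:
  fixes M :: "(real^'n^'n) set"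
  assumes "finite M"
    and "irreducible_set M"
    and "asymptotically_simple M"
  shows "(\<exists>U. extremal_conitope (lifted_set M) U)
    \<and> (\<exists>U. extremal_conitope (lifted_set M) U \<and> (\<forall>u\<in>U. rank u = 1))"
proof -
  have r: "0 < jsr M" and bdd: "bounded (products (normalized M))"
    using assms(3) by (simp_all add: asymptotically_simple_def nondefective_def products_def)
  obtain G w u s where cycle: "leading_cycle (normalized M) G"
    and w: "set w \<subseteq> normalized M" "w \<noteq> []" "u \<noteq> 0" "mat_prod w *v u = s *\<^sub>R u" "\<bar>s\<bar> = 1"
    by (rule asymptotically_simple_imp_leading_cycle[OF assms])
  obtain Z where Z: "finite Z" "0 \<notin> Z" "0 \<in> interior (convex hull Z)"
    and inv: "\<And>A z. A \<in> normalized M \<Longrightarrow> z \<in> Z \<Longrightarrow> A *v z \<in> convex hull Z"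
    by (rule leading_cycle.invariant_polytope[OF cycle]) blast
  have "extremal_conitope (lifted_set M) (outer_square ` Z)"
  proof (rule extremal_conitope_if_invariant_polytope[OF Z(1,3) _ r])
    show "A /\<^sub>R jsr M *v z \<in> convex hull Z" if "A \<in> M" "z \<in> Z" for A z
      using inv that by (auto simp: normalized_def)
    show "jsr_on sym_matrices (lifted_set M) = (jsr M)\<^sup>2"
      using bdd w by (intro jsr_on_lifted_set[OF r]) (simp_all add: normalized_def)
  qed
  moreover have "\<forall>U\<in>outer_square ` Z. rank U = 1"
    using Z(2) rank_outer_square by (metis imageE)
  ultimately show ?thesis
    by blast
qed

end
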